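(* Let $(X,f)$ be a minimal zero-dimensional system ($f$ is a continuous surjection, not necessarily a homeomorphism) with topological rank $K$, where $1\le K\le\infty$. Let $(\hat X_f,\sigma)$ be its natural extension. Then $(\hat X_f,\sigma)$ has topological rank at most $K$.
   Context: **Systems.** A zero-dimensional system is a pair $(X,f)$ with $X$ a compact zero-dimensional metrizable space and $f:X\to X$ a continuous surjection. It is a Cantor system if $X$ has no isolated point. **Natural extension.** $\hat X_f:=\{(x_i)_{i\in\mathbb Z}\in X^{\mathbb Z}\mid f(x_i)=x_{i+1}\text{ for all }i\in\mathbb Z\}$ with the subspace topology of the product, and $(\sigma(\hat x))_i=x_{i+1}$. It is a homeomorphic zero-dimensional system, and it is minimal if $(X,f)$ is. **Graph coverings.** A graph $G=(V,E)$ is a finite vertex set $V$ with a relation $E\subseteq V\times V$ (no multiple edges) such that every $v\in V$ has edges $(u_1,v),(v,u_2)\in E$. We write $V(G)=V$, $E(G)=E$. A graph homomorphism $\varphi:G_1\to G_2$ is a map of vertices sending edges to edges. It is edge-surjective if $\varphi(E_1)=E_2$, and $+$directional if $(u,v),(u,v')\in E_1$ implies $\varphi(v)=\varphi(v')$. A cover is a $+$directional edge-surjective graph homomorphism. A (graph) covering is a sequence of covers $G_0\xleftarrow{\varphi_1}G_1\xleftarrow{\varphi_2}G_2\xleftarrow{\varphi_3}\cdots$ with $G_n=(V_n,E_n)$ and $G_0=(\{v_0\},\{(v_0,v_0)\})$. For $m>n$ put $\varphi_{m,n}=\varphi_{n+1}\circ\cdots\circ\varphi_m$. Its inverse limit is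 the zero-dimensional system $(X,f)$ with $X=\{(x_0,x_1,\dots)\in\prod_n V_n\mid x_i=\varphi_{i+1}(x_{i+1})\ \forall i\}$ (product of discrete topologies) and $f(x)=y$ if and only if $(x_i,y_i)\in E_i$ for all $i$ (this defines a continuous surjection). A walk of length $l$ in $G$ is a sequence $(u_0,\dots,u_l)$ with $(u_i,u_{i+1})\in E$. It is a circuit of period $l$ if $u_0=u_l$ and $u_0,\dots,u_{l-1}$ are mutually distinct. $E(w)$ denotes the set of edges of a walk $w$. **GM-coverings.** A covering is of Gambaudo–Martens type (a GM-covering) if for each $n>0$ there are a vertex $v_{n,0}$ of $G_n$ and finitely many circuits $c_{n,i}$ ($1\le i\le r_n$) of $G_n$, where $\{c_{n,i}\mid 1\le i\le r_n\}$ is the set of all circuits of $G_n$ (listed without repetition, starting at $v_{n,0}$), such that (a) $c_{n,i}=(v_{n,0}=v_{n,i,0},v_{n,i,1},\dots,v_{n,i,l(n,i)}=v_{n,0})$ with $l(n,i)\ge1$; (b) $\bigcup_{i=1}^{r_n}E(c_{n,i})=E(G_n)$; (c) if $v_{n,i,j}=v_{n,i',j'}$ with $j,j'\ge1$, then $v_{n,i,j+k}=v_{n,i',j'+k}$ for $k=0,1,2,\dots$ until $j+k=l(n,i)$ and $j'+k=l(n,i')$ occur at the same time; (d) $\varphi_n(v_{n,0})=v_{n-1,0}$ for all $n\ge1$; (e) $\varphi_n(v_{n,i,1})=v_{n-1,1,1}$ for all $n\ge1$ and $1\le i\le r_n$ (for $n=0$: $v_{0,0}=v_{0,1,1}=v_0$).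 It is simple if for every $n>0$ there is $m>n$ such that $E(\varphi_{m,n}(c_{m,i}))=E(G_n)$ for each $1\le i\le r_m$. Its rank is $\liminf_{n\to\infty}r_n\in\{1,2,\dots,\infty\}$. A zero-dimensional system is minimal if and only if it is topologically conjugate to the inverse limit of a simple GM-covering (Gambaudo–Martens). **Topological rank of a minimal zero-dimensional system.** It is the minimum $K\in\{1,2,\dots,\infty\}$ of the ranks of the simple GM-coverings whose inverse limit is topologically conjugate to the system. **Bratteli–Vershik systems.** A Bratteli diagram $(V,E)$ is an infinite directed graph with partitions into non-empty finite sets $V=V_0\cup V_1\cup\cdots$, $E=E_1\cup E_2\cup\cdots$, $V_0=\{v_0\}$, with source and range maps $s:E_n\to V_{n-1}$, $r:E_n\to V_n$ (multiple edges allowed), $s^{-1}(v)\ne\emptyset$ for all $v\in V$ and $r^{-1}(v)\neq\emptyset$ for all $v\in V\setminus V_0$. Its rank is $\liminf_{n\to\infty}\#V_n$. Telescoping means passing to a subsequence of levels (containing level $0$) with edges between consecutive chosen levels being the paths between them. The diagram is simple if after telescoping any $u\in V_n$ and $v\in V_{n+1}$ are joined by an edge, for all $n\ge0$. An ordered Bratteli diagram carries a linear order on each $r^{-1}(v)$, $v\in V\setminus V_0$. A path is maximal (minimal) if all its edges are maximal (minimal). An ordered diagram is properly ordered if it is simple and has a unique infinite maximal path $x_{\max}$ and a unique infinite minimal path $x_{\min}$ starting at $v_0$. The Vershik map $\phi$ on the infinite path space $E_{0,\infty}=\{(e_1,e_2,\dots)\mid e_i\in E_i,\ r(e_i)=s(e_{i+1})\}$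 (subspace of the product) is: $\phi(x_{\max})=x_{\min}$; for $e\neq x_{\max}$, with $n$ least such that $e_n$ is not maximal, $f_n$ the successor of $e_n$ in $r^{-1}(r(e_n))$, and $(f_1,\dots,f_{n-1})$ the minimal path from $v_0$ to $s(f_n)$, $\phi(e)=(f_1,\dots,f_{n-1},f_n,e_{n+1},e_{n+2},\dots)$. **Topological rank of a minimal homeomorphism.** For a minimal homeomorphic zero-dimensional system, the topological rank is the minimum $K\in\{1,2,\dots,\infty\}$ of the ranks of properly ordered Bratteli diagrams whose Vershik map is topologically conjugate to it. (It is known that for homeomorphic Cantor minimal systems this agrees with the rank defined through simple GM-coverings.) The topological rank of $(\hat X_f,\sigma)$ is understood in this sense, that of $(X,f)$ in the sense of simple GM-coverings. *)

theory Defs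
  imports "HOL-Analysis.Analysis"
begin

section \<open>Zero-dimensional systems\<close>

definition zero_dim_system :: "'a topology \<Rightarrow> ('a \<Rightarrow> 'a) \<Rightarrow> bool" where
  "zero_dim_system X f \<longleftrightarrow>
     topspace X \<noteq> {} \<and> compact_space X \<and> metrizable_space X \<and> X dim_le 0 \<and>
     continuous_map X X f \<and> f ` topspace X = topspace X"

text \<open>All forward orbits are dense.\<close>

definition minimal_system :: "'a topology \<Rightarrow> ('a \<Rightarrow> 'a) \<Rightarrow> bool" where
  "minimal_system X f \<longleftrightarrow>
     (\<forall>x\<in>topspace X. X closure_of (range (\<lambda>n. (f ^^ n) x)) = topspace X)"

definition conjugate_systems ::
  "'a topology \<Rightarrow> ('a \<Rightarrow> 'a) \<Rightarrow> 'b topology \<Rightarrow> ('b \<Rightarrow> 'b) \<Rightarrow> bool" where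
  "conjugate_systems X f Y g \<longleftrightarrow>
     (\<exists>h. homeomorphic_map X Y h \<and> (\<forall>x\<in>topspace X. h (f x) = g (h x)))"

definition natural_extension :: "'a topology \<Rightarrow> ('a \<Rightarrow> 'a) \<Rightarrow> (int \<Rightarrow> 'a) topology" where
  "natural_extension X f =
     subtopology (product_topology (\<lambda>i::int. X) UNIV) {x. \<forall>i. f (x i) = x (i + 1)}"

definition shift :: "(int \<Rightarrow> 'a) \<Rightarrow> (int \<Rightarrow> 'a)" where
  "shift x = (\<lambda>i. x (i + 1))"

definition is_minimum :: "'a::order \<Rightarrow> 'a set \<Rightarrow> bool" where
  "is_minimum k S \<longleftrightarrow> k \<in> S \<and> (\<forall>j\<in>S. k \<le> j)"


section \<open>Graph coverings\<close>

record 'v graph =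
  verts :: "'v set"
  edges :: "('v \<times> 'v) set"

definition is_graph :: "'v graph \<Rightarrow> bool" where
  "is_graph G \<longleftrightarrow> finite (verts G) \<and> edges G \<subseteq> verts G \<times> verts G \<and>
     (\<forall>v\<in>verts G. (\<exists>u. (u, v) \<in> edges G) \<and> (\<exists>u. (v, u) \<in> edges G))"

definition graph_hom :: "'v graph \<Rightarrow> 'v graph \<Rightarrow> ('v \<Rightarrow> 'v) \<Rightarrow> bool" where
  "graph_hom G H p \<longleftrightarrow>
     p ` verts G \<subseteq> verts H \<and> (\<forall>(u, v)\<in>edges G. (p u, p v) \<in> edges H)"

definition edge_surjective :: "'v graph \<Rightarrow> 'v graph \<Rightarrow> ('v \<Rightarrow> 'v) \<Rightarrow> bool" where
  "edge_surjective G H p \<longleftrightarrow> map_prod p p ` edges G = edges H"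

definition plus_directional :: "'v graph \<Rightarrow> ('v \<Rightarrow> 'v) \<Rightarrow> bool" where
  "plus_directional G p \<longleftrightarrow>
     (\<forall>u v v'. (u, v) \<in> edges G \<and> (u, v') \<in> edges G \<longrightarrow> p v = p v')"

definition graph_cover :: "'v graph \<Rightarrow> 'v graph \<Rightarrow> ('v \<Rightarrow> 'v) \<Rightarrow> bool" where
  "graph_cover G H p \<longleftrightarrow> graph_hom G H p \<and> edge_surjective G H p \<and> plus_directional G p"

text \<open>The covers are \<open>\<phi> n : G n \<rightarrow> G (n - 1)\<close> for \<open>n \<ge> 1\<close>; the value \<open>\<phi> 0\<close> is irrelevant.\<close>

definition graph_covering :: "(nat \<Rightarrow> 'v graph) \<Rightarrow> (nat \<Rightarrow> 'v \<Rightarrow> 'v) \<Rightarrow> bool" where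
  "graph_covering G \<phi> \<longleftrightarrow> (\<forall>n. is_graph (G n)) \<and>
     (\<exists>v. verts (G 0) = {v} \<and> edges (G 0) = {(v, v)}) \<and>
     (\<forall>n. graph_cover (G (Suc n)) (G n) (\<phi> (Suc n)))"

text \<open>\<open>comp_cover \<phi> m n = \<phi> (n + 1) \<circ> \<dots> \<circ> \<phi> m\<close>, used for \<open>m > n\<close>.\<close>

primrec comp_cover :: "(nat \<Rightarrow> 'v \<Rightarrow> 'v) \<Rightarrow> nat \<Rightarrow> nat \<Rightarrow> 'v \<Rightarrow> 'v" where
  "comp_cover \<phi> 0 n = id"
| "comp_cover \<phi> (Suc m) n = (if Suc m \<le> n then id else comp_cover \<phi> m n \<circ> \<phi> (Suc m))"

definition inverse_limit ::
  "(nat \<Rightarrow> 'v graph) \<Rightarrow> (nat \<Rightarrow> 'v \<Rightarrow> 'v) \<Rightarrow> (nat \<Rightarrow> 'v) topology" where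
  "inverse_limit G \<phi> =
     subtopology (product_topology (\<lambda>n. discrete_topology (verts (G n))) UNIV)
       {x. \<forall>i. x i = \<phi> (Suc i) (x (Suc i))}"

definition inverse_limit_map ::
  "(nat \<Rightarrow> 'v graph) \<Rightarrow> (nat \<Rightarrow> 'v \<Rightarrow> 'v) \<Rightarrow> (nat \<Rightarrow> 'v) \<Rightarrow> (nat \<Rightarrow> 'v)" where
  "inverse_limit_map G \<phi> x =
     (THE y. y \<in> topspace (inverse_limit G \<phi>) \<and> (\<forall>i. (x i, y i) \<in> edges (G i)))"

text \<open>A walk \<open>(u\<^sub>0, \<dots>, u\<^sub>l)\<close> of length \<open>l\<close> is the list of its \<open>l + 1\<close> vertices.\<close>

definition walk :: "'v graph \<Rightarrow> 'v list \<Rightarrow> bool" where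
  "walk G w \<longleftrightarrow> w \<noteq> [] \<and> set w \<subseteq> verts G \<and>
     (\<forall>i. Suc i < length w \<longrightarrow> (w ! i, w ! Suc i) \<in> edges G)"

definition walk_edges :: "'v list \<Rightarrow> ('v \<times> 'v) set" where
  "walk_edges w = {(w ! i, w ! Suc i) | i. Suc i < length w}"

text \<open>Circuits have period \<open>l \<ge> 1\<close>, so the one-vertex walk is not a circuit.\<close>

definition circuit :: "'v graph \<Rightarrow> 'v list \<Rightarrow> bool" where
  "circuit G w \<longleftrightarrow> walk G w \<and> length w \<ge> 2 \<and> hd w = last w \<and> distinct (butlast w)"

definition circ_len :: "'v list \<Rightarrow> nat" where
  "circ_len w = length w - 1"


section \<open>Coverings of Gambaudo--Martens type\<close>

text \<open>
  \<open>v n\<close>, \<open>r n\<close> and \<open>c n i ! j\<close> are $v_{n,0}$, $r_n$ and $v_{n,i,j}$.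
  ``All circuits'' is read up to the choice of the starting vertex, every listed circuit being
  written from \<open>v n\<close>; \<open>butlast\<close> drops the repeated end point so that changing the starting
  vertex is a list rotation.  For \<open>n = 0\<close> only \<open>v 0\<close> and \<open>c 0 1 ! 1\<close> matter.
\<close>

definition gm_covering ::
  "(nat \<Rightarrow> 'v graph) \<Rightarrow> (nat \<Rightarrow> 'v \<Rightarrow> 'v) \<Rightarrow> (nat \<Rightarrow> 'v) \<Rightarrow> (nat \<Rightarrow> nat) \<Rightarrow>
   (nat \<Rightarrow> nat \<Rightarrow> 'v list) \<Rightarrow> bool" where
  "gm_covering G \<phi> v r c \<longleftrightarrow>
     graph_covering G \<phi> \<and>
     verts (G 0) = {v 0} \<and> c 0 1 ! 1 = v 0 \<and>
     (\<forall>n>0. v n \<in> verts (G n) \<and>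
       (\<forall>i\<in>{1..r n}. circuit (G n) (c n i) \<and> hd (c n i) = v n) \<and>
       inj_on (c n) {1..r n} \<and>
       (\<forall>w. circuit (G n) w \<longrightarrow>
          (\<exists>i\<in>{1..r n}. \<exists>k. butlast w = rotate k (butlast (c n i)))) \<and>
       (\<Union>i\<in>{1..r n}. walk_edges (c n i)) = edges (G n) \<and>
       (\<forall>i\<in>{1..r n}. \<forall>i'\<in>{1..r n}.
          \<forall>j\<in>{1..circ_len (c n i)}. \<forall>j'\<in>{1..circ_len (c n i')}.
            c n i ! j = c n i' ! j' \<longrightarrow>
            (\<exists>k. j + k = circ_len (c n i) \<and> j' + k = circ_len (c n i') \<and>
                 (\<forall>m\<le>k. c n i ! (j + m) = c n i' ! (j' + m)))) \<and>
       \<phi> n (v n) = v (n - 1) \<and>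
       (\<forall>i\<in>{1..r n}. \<phi> n (c n i ! 1) = c (n - 1) 1 ! 1))"

definition gm_simple ::
  "(nat \<Rightarrow> 'v graph) \<Rightarrow> (nat \<Rightarrow> 'v \<Rightarrow> 'v) \<Rightarrow> (nat \<Rightarrow> nat) \<Rightarrow> (nat \<Rightarrow> nat \<Rightarrow> 'v list) \<Rightarrow> bool" where
  "gm_simple G \<phi> r c \<longleftrightarrow>
     (\<forall>n>0. \<exists>m>n. \<forall>i\<in>{1..r m}.
        walk_edges (map (comp_cover \<phi> m n) (c m i)) = edges (G n))"

definition gm_rank :: "(nat \<Rightarrow> nat) \<Rightarrow> enat" where
  "gm_rank r = liminf (\<lambda>n. enat (r n))"

text \<open>Vertices are natural numbers; since the graphs are finite, every covering is isomorphic
  to one of this form.\<close>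

definition gm_ranks :: "'a topology \<Rightarrow> ('a \<Rightarrow> 'a) \<Rightarrow> enat set" where
  "gm_ranks X f =
     {gm_rank r | (G :: nat \<Rightarrow> nat graph) \<phi> v r c.
        gm_covering G \<phi> v r c \<and> gm_simple G \<phi> r c \<and>
        conjugate_systems X f (inverse_limit G \<phi>) (inverse_limit_map G \<phi>)}"

definition has_topological_rank :: "'a topology \<Rightarrow> ('a \<Rightarrow> 'a) \<Rightarrow> enat \<Rightarrow> bool" where
  "has_topological_rank X f K \<longleftrightarrow> is_minimum K (gm_ranks X f)"


section \<open>Bratteli--Vershik systems\<close>

text \<open>The edge set \<open>bedges B n\<close> joins level \<open>n - 1\<close> to level \<open>n\<close> and is relevant for
  \<open>n \<ge> 1\<close> only.\<close>

record ('v, 'e) bratteli =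
  bverts :: "nat \<Rightarrow> 'v set"
  bedges :: "nat \<Rightarrow> 'e set"
  src :: "'e \<Rightarrow> 'v"
  rng :: "'e \<Rightarrow> 'v"

definition bratteli_diagram :: "('v, 'e) bratteli \<Rightarrow> bool" where
  "bratteli_diagram B \<longleftrightarrow>
     (\<exists>v0. bverts B 0 = {v0}) \<and>
     (\<forall>n. finite (bverts B n) \<and> bverts B n \<noteq> {}) \<and>
     (\<forall>n\<ge>1. finite (bedges B n) \<and> bedges B n \<noteq> {}) \<and>
     (\<forall>m n. m \<noteq> n \<longrightarrow> bverts B m \<inter> bverts B n = {}) \<and>
     (\<forall>m\<ge>1. \<forall>n\<ge>1. m \<noteq> n \<longrightarrow> bedges B m \<inter> bedges B n = {}) \<and>
     (\<forall>n\<ge>1. \<forall>e\<in>bedges B n. src B e \<in> bverts B (n - 1) \<and> rng B e \<in> bverts B n) \<and>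
     (\<forall>n. \<forall>v\<in>bverts B n. \<exists>e\<in>bedges B (Suc n). src B e = v) \<and>
     (\<forall>n\<ge>1. \<forall>v\<in>bverts B n. \<exists>e\<in>bedges B n. rng B e = v)"

definition bratteli_rank :: "('v, 'e) bratteli \<Rightarrow> enat" where
  "bratteli_rank B = liminf (\<lambda>n. enat (card (bverts B n)))"

definition finite_paths :: "('v, 'e) bratteli \<Rightarrow> nat \<Rightarrow> nat \<Rightarrow> 'e list set" where
  "finite_paths B m n =
     {p. length p = n - m \<and> (\<forall>i<n - m. p ! i \<in> bedges B (m + Suc i)) \<and>
         (\<forall>i. Suc i < n - m \<longrightarrow> rng B (p ! i) = src B (p ! Suc i))}"

definition telescope :: "('v, 'e) bratteli \<Rightarrow> (nat \<Rightarrow> nat) \<Rightarrow> ('v, 'e list) bratteli" where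
  "telescope B k =
     \<lparr>bverts = (\<lambda>n. bverts B (k n)),
      bedges = (\<lambda>n. finite_paths B (k (n - 1)) (k n)),
      src = (\<lambda>p. src B (hd p)),
      rng = (\<lambda>p. rng B (last p))\<rparr>"

definition simple_bratteli :: "('v, 'e) bratteli \<Rightarrow> bool" where
  "simple_bratteli B \<longleftrightarrow>
     (\<exists>k. strict_mono k \<and> k 0 = 0 \<and>
        (\<forall>n. \<forall>u\<in>bverts (telescope B k) n. \<forall>v\<in>bverts (telescope B k) (Suc n).
           \<exists>e\<in>bedges (telescope B k) (Suc n).
             src (telescope B k) e = u \<and> rng (telescope B k) e = v))"

definition incoming :: "('v, 'e) bratteli \<Rightarrow> 'v \<Rightarrow> 'e set" where
  "incoming B v = {e. (\<exists>n\<ge>1. e \<in> bedges B n) \<and> rng B e = v}"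

text \<open>\<open>ord v\<close> is the (reflexive) linear order on the edges with range \<open>v\<close>.\<close>

definition ordered_bratteli :: "('v, 'e) bratteli \<Rightarrow> ('v \<Rightarrow> 'e rel) \<Rightarrow> bool" where
  "ordered_bratteli B ord \<longleftrightarrow>
     bratteli_diagram B \<and> (\<forall>n\<ge>1. \<forall>v\<in>bverts B n. linear_order_on (incoming B v) (ord v))"

definition max_edge :: "('v, 'e) bratteli \<Rightarrow> ('v \<Rightarrow> 'e rel) \<Rightarrow> 'e \<Rightarrow> bool" where
  "max_edge B ord e \<longleftrightarrow> (\<forall>g\<in>incoming B (rng B e). (g, e) \<in> ord (rng B e))"

definition min_edge :: "('v, 'e) bratteli \<Rightarrow> ('v \<Rightarrow> 'e rel) \<Rightarrow> 'e \<Rightarrow> bool" where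
  "min_edge B ord e \<longleftrightarrow> (\<forall>g\<in>incoming B (rng B e). (e, g) \<in> ord (rng B e))"

text \<open>An infinite path \<open>(e\<^sub>1, e\<^sub>2, \<dots>)\<close> is the sequence \<open>x\<close> with \<open>x n\<close> equal to the
  \<open>(n + 1)\<close>-st edge.\<close>

definition path_space :: "('v, 'e) bratteli \<Rightarrow> (nat \<Rightarrow> 'e) topology" where
  "path_space B =
     subtopology (product_topology (\<lambda>n. discrete_topology (bedges B (Suc n))) UNIV)
       {x. \<forall>n. rng B (x n) = src B (x (Suc n))}"

definition max_path :: "('v, 'e) bratteli \<Rightarrow> ('v \<Rightarrow> 'e rel) \<Rightarrow> (nat \<Rightarrow> 'e) \<Rightarrow> bool" where
  "max_path B ord x \<longleftrightarrow> x \<in> topspace (path_space B) \<and> (\<forall>n. max_edge B ord (x n))"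

definition min_path :: "('v, 'e) bratteli \<Rightarrow> ('v \<Rightarrow> 'e rel) \<Rightarrow> (nat \<Rightarrow> 'e) \<Rightarrow> bool" where
  "min_path B ord x \<longleftrightarrow> x \<in> topspace (path_space B) \<and> (\<forall>n. min_edge B ord (x n))"

definition properly_ordered :: "('v, 'e) bratteli \<Rightarrow> ('v \<Rightarrow> 'e rel) \<Rightarrow> bool" where
  "properly_ordered B ord \<longleftrightarrow>
     ordered_bratteli B ord \<and> simple_bratteli B \<and>
     (\<exists>!x. max_path B ord x) \<and> (\<exists>!x. min_path B ord x)"

definition edge_succ :: "('v, 'e) bratteli \<Rightarrow> ('v \<Rightarrow> 'e rel) \<Rightarrow> 'e \<Rightarrow> 'e" where
  "edge_succ B ord e =
     (let lt = (\<lambda>a b. a \<noteq> b \<and> (a, b) \<in> ord (rng B e)) in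
      THE f. f \<in> incoming B (rng B e) \<and> lt e f \<and>
             (\<forall>g\<in>incoming B (rng B e). \<not> (lt e g \<and> lt g f)))"

text \<open>The minimal path from the top vertex to a vertex \<open>v\<close> of level \<open>n\<close>; it is empty for
  \<open>n = 0\<close>.\<close>

definition min_path_to ::
  "('v, 'e) bratteli \<Rightarrow> ('v \<Rightarrow> 'e rel) \<Rightarrow> nat \<Rightarrow> 'v \<Rightarrow> 'e list" where
  "min_path_to B ord n v =
     (THE p. p \<in> finite_paths B 0 n \<and> (\<forall>e\<in>set p. min_edge B ord e) \<and>
             (p \<noteq> [] \<longrightarrow> rng B (last p) = v))"

definition vershik_map ::
  "('v, 'e) bratteli \<Rightarrow> ('v \<Rightarrow> 'e rel) \<Rightarrow> (nat \<Rightarrow> 'e) \<Rightarrow> (nat \<Rightarrow> 'e)" where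
  "vershik_map B ord x =
     (if max_path B ord x then (THE y. min_path B ord y)
      else
        let n = (LEAST n. \<not> max_edge B ord (x n));
            f = edge_succ B ord (x n);
            p = min_path_to B ord n (src B f)
        in (\<lambda>i. if i < n then p ! i else if i = n then f else x i))"

text \<open>Vertices and edges are natural numbers; as all levels are finite, every diagram is
  isomorphic to one of this form.\<close>

definition bv_ranks :: "'a topology \<Rightarrow> ('a \<Rightarrow> 'a) \<Rightarrow> enat set" where
  "bv_ranks X f =
     {bratteli_rank B | (B :: (nat, nat) bratteli) ord.
        properly_ordered B ord \<and> conjugate_systems X f (path_space B) (vershik_map B ord)}"

definition has_homeo_topological_rank :: "'a topology \<Rightarrow> ('a \<Rightarrow> 'a) \<Rightarrow> enat \<Rightarrow> bool" where
  "has_homeo_topological_rank X f K \<longleftrightarrow> is_minimum K (bv_ranks X f)"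

end

theory Submission
  imports Defs
begin

text \<open>
Let a simple covering of Gambaudo--Martens type have inverse limit $(Y,g)$.  The circuits of the
graphs $G_n$ are the natural vertices of a Bratteli diagram: \<open>\<phi>\<close> sends a circuit of $G_{n+1}$ to a
closed walk based at $v_{n,0}$.  Circuits that meet outside the base vertex coincide from there on,
so this walk splits uniquely into circuits of $G_n$, and the order of the pieces orders the incoming
edges.  All these walks begin with the same edge, so the first piece is always $c_{n,1}$ and the
minimal path is unique.  The last pieces may differ, which leaves several maximal paths: the past of
the point $(v_{0,0}, v_{1,0}, \dots)$ is not visible in the diagram.

On the natural extension this is cured by observing higher levels further in the past.  Let $\delta_n$ be the
length of $c_{n,1}$ for even $n$ and $0$ for odd $n$, put $m_n = \sum_{j<n} \delta_j$, and use at
level $n$ the clopen base set $\{\hat x \mid (\hat x_{-m_n})_n = v_{n,0}\}$.  Every circuit of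
$G_{n+1}$ projects to a walk that begins with $c_{n,1}$, so these base sets are still nested.  In terms of
the diagram, at even levels the piece $c_{n,1}$ is moved from the front of each list of pieces to
its end.  The vertices and the incidences, hence the rank and simplicity, do not change.
But now every maximal edge above an even level starts in $c_{n,1}$, and so does every minimal
edge above an odd level: the diagram is properly ordered (\<open>properly_ordered_diagram\<close>).

A point of the natural extension is an array \<open>a k n\<close> (time \<open>k\<close>, level \<open>n\<close>).  Its itinerary
records, for each level, the circuit that is being traversed at time $-m_n$ and the position of
this traversal inside the one of the level above.  One step of time changes the itinerary exactly as
the Vershik map does (\<open>itinerary_shift\<close>): the traversals that end are those of an initial segment
of levels.  Equal itineraries have equal Vershik orbits, so the two arrays agree at
level $n$ from time $-m_n$ on; as $m_n \to \infty$, they are equal (\<open>itinerary_inject\<close>).  Each finite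
path is the beginning of an itinerary (\<open>prefix_realized\<close>), and compactness gives
surjectivity.  So the Vershik map is conjugate to the shift (\<open>conjugate_natural_extension\<close>), the
rank of the covering lies in the set of ranks whose minimum is sought, and the minimum exists
because extended natural numbers are well ordered.
\<close>

section \<open>Ordered Bratteli diagrams given by sets of positions\<close>

text \<open>
The topological rank of a homeomorphism is defined by diagrams on natural numbers; so vertex \<open>i\<close>
of level \<open>n\<close>, and the edge at position \<open>p\<close> from level \<open>n\<close> into vertex \<open>i\<close> of level \<open>n + 1\<close>,
are packed into natural numbers.
\<close>

definition vtx :: "nat \<Rightarrow> nat \<Rightarrow> nat" where
  "vtx n i = prod_encode (n, i)"

definition edg :: "nat \<Rightarrow> nat \<Rightarrow> nat \<Rightarrow> nat" where
  "edg n i p = prod_encode (n, prod_encode (i, p))"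

definition edg_pos :: "nat \<Rightarrow> nat" where
  "edg_pos e = snd (prod_decode (snd (prod_decode e)))"

lemma vtx_inject [simp]: "vtx n i = vtx m j \<longleftrightarrow> n = m \<and> i = j"
  by (simp add: vtx_def)

lemma edg_inject [simp]: "edg n i p = edg m j q \<longleftrightarrow> n = m \<and> i = j \<and> p = q"
  by (simp add: edg_def)

lemma edg_pos_edg [simp]: "edg_pos (edg n i p) = p"
  by (simp add: edg_pos_def edg_def)

text \<open>
A diagram whose edges into vertex \<open>i\<close> of level \<open>n + 1\<close> are labelled by a finite set \<open>P n i\<close> of
numbers and ordered by size; the edge at position \<open>p\<close> starts in vertex \<open>S n i p\<close> of level \<open>n\<close>.
Positions keep their gaps: in the application a position is a time, and an initial segment of the
natural numbers would lose it.
\<close>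

locale position_diagram =
  fixes r :: "nat \<Rightarrow> nat" and P :: "nat \<Rightarrow> nat \<Rightarrow> nat set" and S :: "nat \<Rightarrow> nat \<Rightarrow> nat \<Rightarrow> nat"
  assumes r_0: "r 0 = 1"
    and r_pos: "1 \<le> r n"
    and P_finite: "i \<in> {1..r (Suc n)} \<Longrightarrow> finite (P n i)"
    and P_nonempty: "i \<in> {1..r (Suc n)} \<Longrightarrow> P n i \<noteq> {}"
    and S_in: "i \<in> {1..r (Suc n)} \<Longrightarrow> p \<in> P n i \<Longrightarrow> S n i p \<in> {1..r n}"
    and S_onto: "j \<in> {1..r n} \<Longrightarrow> \<exists>i\<in>{1..r (Suc n)}. \<exists>p\<in>P n i. S n i p = j"
begin

definition diagram :: "(nat, nat) bratteli" where
  "diagram =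
     \<lparr>bverts = (\<lambda>n. vtx n ` {1..r n}),
      bedges = (\<lambda>n. case n of 0 \<Rightarrow> {} | Suc m \<Rightarrow> {edg m i p | i p. i \<in> {1..r (Suc m)} \<and> p \<in> P m i}),
      src = (\<lambda>e. case prod_decode e of (n, x) \<Rightarrow> case prod_decode x of (i, p) \<Rightarrow> vtx n (S n i p)),
      rng = (\<lambda>e. case prod_decode e of (n, x) \<Rightarrow> case prod_decode x of (i, p) \<Rightarrow> vtx (Suc n) i)\<rparr>"

definition pos_order :: "nat \<Rightarrow> nat rel" where
  "pos_order v = {(e, e'). e \<in> incoming diagram v \<and> e' \<in> incoming diagram v \<and>
                           edg_pos e \<le> edg_pos e'}"

lemma bverts_diagram [simp]: "bverts diagram n = vtx n ` {1..r n}"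
  by (simp add: diagram_def)

lemma bedges_diagram_Suc [simp]:
  "bedges diagram (Suc n) = {edg n i p | i p. i \<in> {1..r (Suc n)} \<and> p \<in> P n i}"
  by (simp add: diagram_def)

lemma src_edg [simp]: "src diagram (edg n i p) = vtx n (S n i p)"
  by (simp add: diagram_def edg_def)

lemma rng_edg [simp]: "rng diagram (edg n i p) = vtx (Suc n) i"
  by (simp add: diagram_def edg_def)

lemma bedges_pos:
  assumes "1 \<le> n"
  shows "bedges diagram n = {edg (n - 1) i p | i p. i \<in> {1..r n} \<and> p \<in> P (n - 1) i}"
  using assms by (cases n) auto

lemma finite_bedges: "finite (bedges diagram (Suc n))"
proof -
  have "bedges diagram (Suc n) = (\<Union>i\<in>{1..r (Suc n)}. edg n i ` P n i)"
    by auto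
  then show ?thesis using P_finite by auto
qed

lemma bratteli_diagram_diagram: "bratteli_diagram diagram"
  unfolding bratteli_diagram_def
proof (intro conjI allI impI ballI)
  show "\<exists>v0. bverts diagram 0 = {v0}"
    by (simp add: r_0)
next
  fix n show "finite (bverts diagram n)" by simp
next
  fix n show "bverts diagram n \<noteq> {}" using r_pos[of n] by auto
next
  fix n :: nat assume "1 \<le> n"
  then show "finite (bedges diagram n)"
    using finite_bedges[of "n - 1"] by (metis Suc_diff_1 less_eq_Suc_le One_nat_def)
next
  fix n :: nat assume n: "1 \<le> n"
  have one: "1 \<in> {1..r (Suc (n - 1))}" using r_pos[of "Suc (n - 1)"] by auto
  then obtain p where "p \<in> P (n - 1) 1" using P_nonempty[OF one] by auto
  then have "edg (n - 1) 1 p \<in> bedges diagram n"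
    unfolding bedges_pos[OF n] using one n by auto
  then show "bedges diagram n \<noteq> {}" by blast
next
  fix m n :: nat assume "m \<noteq> n"
  then show "bverts diagram m \<inter> bverts diagram n = {}" by auto
next
  fix m n :: nat assume "1 \<le> m" "1 \<le> n" "m \<noteq> n"
  then show "bedges diagram m \<inter> bedges diagram n = {}"
    by (auto simp: bedges_pos)
next
  fix n :: nat and e assume n: "1 \<le> n" and e: "e \<in> bedges diagram n"
  then obtain m where m: "n = Suc m" by (cases n) auto
  show "src diagram e \<in> bverts diagram (n - 1)" "rng diagram e \<in> bverts diagram n"
    using e S_in unfolding m by auto
next
  fix n v assume "v \<in> bverts diagram n"
  then obtain j where j: "j \<in> {1..r n}" "v = vtx n j" by auto
  with S_onto obtain i p where "i \<in> {1..r (Suc n)}" "p \<in> P n i" "S n i p = j" by blast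
  then show "\<exists>e\<in>bedges diagram (Suc n). src diagram e = v"
    using j by (intro bexI[of _ "edg n i p"]) auto
next
  fix n :: nat and v assume n: "1 \<le> n" and v: "v \<in> bverts diagram n"
  then obtain m where m: "n = Suc m" by (cases n) auto
  from v obtain j where j: "j \<in> {1..r n}" "v = vtx n j" by auto
  then obtain p where "p \<in> P m j" using P_nonempty m by blast
  then show "\<exists>e\<in>bedges diagram n. rng diagram e = v"
    using j unfolding m by (intro bexI[of _ "edg m j p"]) auto
qed

lemma incoming_vtx:
  assumes "i \<in> {1..r (Suc n)}"
  shows "incoming diagram (vtx (Suc n) i) = edg n i ` P n i"
proof (intro set_eqI iffI)
  fix e assume "e \<in> incoming diagram (vtx (Suc n) i)"
  then obtain m where m: "1 \<le> m" "e \<in> bedges diagram m" "rng diagram e = vtx (Suc n) i"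
    unfolding incoming_def by auto
  then show "e \<in> edg n i ` P n i" by (auto simp: bedges_pos)
next
  fix e assume "e \<in> edg n i ` P n i"
  then have "e \<in> bedges diagram (Suc n)" "rng diagram e = vtx (Suc n) i"
    using assms by auto
  then show "e \<in> incoming diagram (vtx (Suc n) i)"
    unfolding incoming_def by (auto intro!: exI[of _ "Suc n"])
qed

lemma ordered_bratteli_diagram: "ordered_bratteli diagram pos_order"
  unfolding ordered_bratteli_def
proof (intro conjI allI impI ballI bratteli_diagram_diagram)
  fix n :: nat and v assume n: "1 \<le> n" and v: "v \<in> bverts diagram n"
  then obtain m where m: "n = Suc m" by (cases n) auto
  from v m obtain i where i: "i \<in> {1..r (Suc m)}" "v = vtx (Suc m) i" by auto
  show "linear_order_on (incoming diagram v) (pos_order v)"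
    unfolding linear_order_on_def partial_order_on_def preorder_on_def pos_order_def
      i(2) incoming_vtx[OF i(1)]
    by (auto simp: refl_on_def total_on_def antisym_def intro!: transI)
qed

lemma max_edge_iff:
  assumes "i \<in> {1..r (Suc n)}" "p \<in> P n i"
  shows "max_edge diagram pos_order (edg n i p) \<longleftrightarrow> p = Max (P n i)"
proof -
  have "max_edge diagram pos_order (edg n i p) \<longleftrightarrow> (\<forall>p'\<in>P n i. p' \<le> p)"
    using assms by (auto simp: max_edge_def pos_order_def incoming_vtx)
  also have "\<dots> \<longleftrightarrow> p = Max (P n i)"
    using assms P_finite[OF assms(1)] by (auto intro!: Max_eqI[symmetric])
  finally show ?thesis .
qed

lemma min_edge_iff:
  assumes "i \<in> {1..r (Suc n)}" "p \<in> P n i"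
  shows "min_edge diagram pos_order (edg n i p) \<longleftrightarrow> p = Min (P n i)"
proof -
  have "min_edge diagram pos_order (edg n i p) \<longleftrightarrow> (\<forall>p'\<in>P n i. p \<le> p')"
    using assms by (auto simp: min_edge_def pos_order_def incoming_vtx)
  also have "\<dots> \<longleftrightarrow> p = Min (P n i)"
    using assms P_finite[OF assms(1)] by (auto intro!: Min_eqI[symmetric])
  finally show ?thesis .
qed

lemma path_space_iff:
  "x \<in> topspace (path_space diagram) \<longleftrightarrow>
     (\<forall>n. x n \<in> bedges diagram (Suc n)) \<and> (\<forall>n. rng diagram (x n) = src diagram (x (Suc n)))"
  unfolding path_space_def
  by (simp del: bedges_diagram_Suc add: PiE_UNIV_domain Pi_iff)

lemma path_coordinates:
  assumes "x \<in> topspace (path_space diagram)"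
  obtains I p where "\<And>n. x n = edg n (I (Suc n)) (p n)" "\<And>n. I n \<in> {1..r n}"
    "\<And>n. p n \<in> P n (I (Suc n))" "\<And>n. I n = S n (I (Suc n)) (p n)"
proof -
  have "\<forall>n. \<exists>i p. x n = edg n i p \<and> i \<in> {1..r (Suc n)} \<and> p \<in> P n i"
    using assms unfolding path_space_iff by simp
  then obtain J p where J: "\<And>n. x n = edg n (J n) (p n)" "\<And>n. J n \<in> {1..r (Suc n)}"
    "\<And>n. p n \<in> P n (J n)" by metis
  have link: "J n = S (Suc n) (J (Suc n)) (p (Suc n))" for n
  proof -
    have "rng diagram (x n) = src diagram (x (Suc n))"
      using assms unfolding path_space_iff by blast
    then show ?thesis by (simp only: J(1) rng_edg src_edg vtx_inject)
  qed
  define I where "I n = (case n of 0 \<Rightarrow> 1 | Suc m \<Rightarrow> J m)" for n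
  show thesis
  proof (rule that[of I p])
    fix n
    show "x n = edg n (I (Suc n)) (p n)" "p n \<in> P n (I (Suc n))" using J by (auto simp: I_def)
    show "I n \<in> {1..r n}" using J(2) r_0 by (auto simp: I_def split: nat.split)
    show "I n = S n (I (Suc n)) (p n)"
    proof (cases n)
      case 0
      then show ?thesis using S_in[OF J(2)[of 0] J(3)[of 0]] r_0 by (simp add: I_def)
    next
      case (Suc m)
      then show ?thesis using link[of m] by (simp add: I_def)
    qed
  qed
qed

lemma path_of_coordinates:
  assumes "\<And>n. I n \<in> {1..r n}" "\<And>n. p n \<in> P n (I (Suc n))"
    "\<And>n. I n = S n (I (Suc n)) (p n)"
  shows "(\<lambda>n. edg n (I (Suc n)) (p n)) \<in> topspace (path_space diagram)"
  unfolding path_space_iff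
proof (intro conjI allI)
  fix n
  show "edg n (I (Suc n)) (p n) \<in> bedges diagram (Suc n)" using assms(1,2) by auto
  show "rng diagram (edg n (I (Suc n)) (p n)) = src diagram (edg (Suc n) (I (Suc (Suc n))) (p (Suc n)))"
    using assms(3)[of "Suc n"] by simp
qed

text \<open>
Serves maximal and minimal edges alike.  If on every second level the selected edges all start in
vertex 1, then a path of selected edges has to visit vertex 1 there, and from such a vertex
downwards it is determined by its range vertices.
\<close>

lemma unique_extremal_path:
  assumes ext: "\<And>n i. i \<in> {1..r (Suc n)} \<Longrightarrow> ext n i \<in> P n i"
    and Q: "\<And>n i p. i \<in> {1..r (Suc n)} \<Longrightarrow> p \<in> P n i \<Longrightarrow> Q (edg n i p) \<longleftrightarrow> p = ext n i"
    and one: "\<And>n i. even n = b \<Longrightarrow> i \<in> {1..r (Suc n)} \<Longrightarrow> S n i (ext n i) = 1"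
  shows "\<exists>!x. x \<in> topspace (path_space diagram) \<and> (\<forall>n. Q (x n))"
proof -
  define T where "T n i = S n i (ext n i)" for n i
  \<comment> \<open>Between two levels where the path is at vertex 1 there is a single level, and its
    vertex is the source of the edge selected at vertex 1 above it.\<close>
  define u where "u n = (if even n = b then 1 else T n 1)" for n
  have one_in: "1 \<in> {1..r n}" for n using r_pos[of n] by auto
  have u_in: "u n \<in> {1..r n}" for n
    using one_in S_in[OF one_in ext[OF one_in]] by (simp add: u_def T_def)
  have u_T: "u n = T n (u (Suc n))" for n
  proof (cases "even n = b")
    case True
    then show ?thesis using one[OF True u_in[of "Suc n"]] by (simp add: u_def T_def)
  next
    case False
    then have "u (Suc n) = 1" by (auto simp: u_def)
    then show ?thesis using False by (simp add: u_def)
  qed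
  let ?x = "\<lambda>n. edg n (u (Suc n)) (ext n (u (Suc n)))"
  show ?thesis
  proof (rule ex1I[of _ ?x])
    have "?x \<in> topspace (path_space diagram)"
      by (rule path_of_coordinates[of u, OF u_in ext[OF u_in] u_T[unfolded T_def]])
    moreover have "Q (?x n)" for n using Q[OF u_in ext[OF u_in]] by simp
    ultimately show "?x \<in> topspace (path_space diagram) \<and> (\<forall>n. Q (?x n))" by blast
  next
    fix y assume y: "y \<in> topspace (path_space diagram) \<and> (\<forall>n. Q (y n))"
    then obtain I p where I: "\<And>n. y n = edg n (I (Suc n)) (p n)" "\<And>n. I n \<in> {1..r n}"
      "\<And>n. p n \<in> P n (I (Suc n))" "\<And>n. I n = S n (I (Suc n)) (p n)"
      using path_coordinates[of y] by blast
    have p: "p n = ext n (I (Suc n))" for n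
      using y Q[OF I(2,3)] I(1) by metis
    have I_b: "I n = 1" if "even n = b" for n
      using I(4)[of n] one[OF that I(2)] p by simp
    have "I n = u n" for n
    proof (cases "even n = b")
      case True then show ?thesis by (simp add: I_b u_def)
    next
      case False
      then have "I (Suc n) = 1" by (intro I_b) auto
      then show ?thesis using False I(4)[of n] p[of n] by (simp add: u_def T_def)
    qed
    then show "y = ?x" using I(1) p by auto
  qed
qed

lemma properly_orderedI:
  assumes "simple_bratteli diagram"
    and "\<And>n i. even n \<Longrightarrow> i \<in> {1..r (Suc n)} \<Longrightarrow> S n i (Max (P n i)) = 1"
    and "\<And>n i. odd n \<Longrightarrow> i \<in> {1..r (Suc n)} \<Longrightarrow> S n i (Min (P n i)) = 1"
  shows "properly_ordered diagram pos_order"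
proof -
  have "\<exists>!x. x \<in> topspace (path_space diagram) \<and> (\<forall>n. max_edge diagram pos_order (x n))"
    by (rule unique_extremal_path[where b = True and ext = "\<lambda>n i. Max (P n i)"])
      (use P_finite P_nonempty max_edge_iff assms in auto)
  moreover have "\<exists>!x. x \<in> topspace (path_space diagram) \<and> (\<forall>n. min_edge diagram pos_order (x n))"
    by (rule unique_extremal_path[where b = False and ext = "\<lambda>n i. Min (P n i)"])
      (use P_finite P_nonempty min_edge_iff assms in auto)
  ultimately show ?thesis
    using assms(1) ordered_bratteli_diagram
    unfolding properly_ordered_def max_path_def min_path_def by blast
qed

text \<open>
Level 0 has a single vertex, which is joined to all of level 1; above it the hypothesis picks the
levels of the telescoping one after the other.
\<close>

lemma simple_diagramI:
  assumes conn: "\<And>n. n > 0 \<Longrightarrow> \<exists>m>n. \<forall>j\<in>{1..r n}. \<forall>i\<in>{1..r m}.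
     \<exists>I p. I n = j \<and> I m = i \<and> (\<forall>k\<in>{n..<m}. I (Suc k) \<in> {1..r (Suc k)} \<and>
        p k \<in> P k (I (Suc k)) \<and> S k (I (Suc k)) (p k) = I k)"
  shows "simple_bratteli diagram"
proof -
  define good where "good n m \<longleftrightarrow> m > n \<and> (\<forall>j\<in>{1..r n}. \<forall>i\<in>{1..r m}.
     \<exists>I p. I n = j \<and> I m = i \<and> (\<forall>k\<in>{n..<m}. I (Suc k) \<in> {1..r (Suc k)} \<and>
        p k \<in> P k (I (Suc k)) \<and> S k (I (Suc k)) (p k) = I k))" for n m
  have good_0: "good 0 1"
    unfolding good_def
  proof (intro conjI ballI)
    fix j i assume j: "j \<in> {1..r 0}" and i: "i \<in> {1..r 1}"
    then obtain p where "p \<in> P 0 i" using P_nonempty[of i 0] by auto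
    moreover have "S 0 i p = j" using S_in[of i 0 p] i j calculation r_0 by auto
    ultimately show "\<exists>I p. I 0 = j \<and> I 1 = i \<and> (\<forall>k\<in>{0..<1}. I (Suc k) \<in> {1..r (Suc k)} \<and>
        p k \<in> P k (I (Suc k)) \<and> S k (I (Suc k)) (p k) = I k)"
      using i j by (intro exI[of _ "\<lambda>n. if n = 0 then j else i"] exI[of _ "\<lambda>_. p"]) auto
  qed simp
  have "\<exists>m. good n m" for n
    using conn[of n] good_0 by (cases "n = 0") (auto simp: good_def)
  then obtain nxt where nxt: "\<And>n. good n (nxt n)" by metis
  define k where "k n = (nxt ^^ n) 0" for n
  have k_Suc: "good (k n) (k (Suc n))" for n
    using nxt by (simp add: k_def)
  show ?thesis
    unfolding simple_bratteli_def
  proof (intro exI[of _ k] conjI allI ballI)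
    show "strict_mono k"
      using k_Suc by (intro strict_mono_Suc_iff[THEN iffD2]) (auto simp: good_def)
    show "k 0 = 0" by (simp add: k_def)
  next
    fix n u v
    assume "u \<in> bverts (telescope diagram k) n" "v \<in> bverts (telescope diagram k) (Suc n)"
    then obtain j i where j: "j \<in> {1..r (k n)}" "u = vtx (k n) j"
      and i: "i \<in> {1..r (k (Suc n))}" "v = vtx (k (Suc n)) i"
      by (auto simp: telescope_def)
    define a b where "a = k n" and "b = k (Suc n)"
    have ab: "a < b" using k_Suc[of n] by (simp add: a_def b_def good_def)
    from k_Suc[of n] i j obtain I p where Ip: "I a = j" "I b = i"
      "\<And>k. k \<in> {a..<b} \<Longrightarrow> I (Suc k) \<in> {1..r (Suc k)} \<and>
        p k \<in> P k (I (Suc k)) \<and> S k (I (Suc k)) (p k) = I k"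
      unfolding good_def a_def b_def by blast
    let ?e = "map (\<lambda>k. edg k (I (Suc k)) (p k)) [a..<b]"
    have "?e \<in> finite_paths diagram a b"
      using Ip(3) unfolding finite_paths_def by auto
    moreover have "src diagram (hd ?e) = u"
      using ab Ip(3)[of a] Ip(1) j by (simp add: hd_map a_def)
    moreover have "rng diagram (last ?e) = v"
      using ab Ip(2) i by (simp add: last_map b_def)
    ultimately show "\<exists>e\<in>bedges (telescope diagram k) (Suc n).
           src (telescope diagram k) e = u \<and> rng (telescope diagram k) e = v"
      by (intro bexI[of _ ?e]) (auto simp: telescope_def a_def b_def)
  qed
qed

text \<open>
A minimal edge is determined by its range, so a minimal path to a given vertex can be recovered
from its last edge downwards.
\<close>

lemma min_path_to_eq:
  assumes y: "y \<in> topspace (path_space diagram)"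
    and min: "\<And>n. n < N \<Longrightarrow> min_edge diagram pos_order (y n)"
    and v: "v = src diagram (y N)"
  shows "min_path_to diagram pos_order N v = map y [0..<N]"
  unfolding min_path_to_def
proof (rule the_equality)
  have "map y [0..<N] \<in> finite_paths diagram 0 N"
    using y unfolding path_space_iff finite_paths_def by (auto simp del: bedges_diagram_Suc)
  moreover have "rng diagram (last (map y [0..<N])) = v" if "N \<noteq> 0"
  proof -
    have "last (map y [0..<N]) = y (N - 1)" using that by (simp add: last_map)
    then show ?thesis using y that v unfolding path_space_iff
      by (metis Suc_diff_1 not_gr_zero)
  qed
  ultimately show "map y [0..<N] \<in> finite_paths diagram 0 N \<and>
     (\<forall>e\<in>set (map y [0..<N]). min_edge diagram pos_order e) \<and>
     (map y [0..<N] \<noteq> [] \<longrightarrow> rng diagram (last (map y [0..<N])) = v)"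
    using min by auto
next
  fix p
  assume p: "p \<in> finite_paths diagram 0 N \<and> (\<forall>e\<in>set p. min_edge diagram pos_order e) \<and>
     (p \<noteq> [] \<longrightarrow> rng diagram (last p) = v)"
  then have len: "length p = N" by (simp add: finite_paths_def)
  have same: "e = e'"
    if "e \<in> bedges diagram (Suc n)" "e' \<in> bedges diagram (Suc n)" "rng diagram e = rng diagram e'"
      "min_edge diagram pos_order e" "min_edge diagram pos_order e'" for e e' n
    using that by (auto simp: min_edge_iff)
  have p_in: "p ! k \<in> bedges diagram (Suc k)" if "k < N" for k
    using p that unfolding finite_paths_def by auto
  have y_in: "y k \<in> bedges diagram (Suc k)" for k
    using y unfolding path_space_iff by blast
  have from_end: "p ! (N - Suc k) = y (N - Suc k)" if "k < N" for k
    using that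
  proof (induction k)
    case 0
    then have "p \<noteq> []" using len by auto
    then have "rng diagram (p ! (N - 1)) = v" using p len by (simp add: last_conv_nth)
    moreover have "rng diagram (y (N - 1)) = v"
      using y 0 v unfolding path_space_iff by (metis Suc_diff_1)
    ultimately show ?case
      using same[OF p_in y_in, of "N - 1"] p min 0 len by auto
  next
    case (Suc k)
    let ?l = "N - Suc (Suc k)"
    have l: "Suc ?l = N - Suc k" "?l < N" using Suc.prems by auto
    have "rng diagram (p ! ?l) = src diagram (p ! Suc ?l)"
      using p l Suc.prems unfolding finite_paths_def by auto
    also have "\<dots> = rng diagram (y ?l)"
      using Suc l y unfolding path_space_iff by (metis Suc_lessD)
    finally show ?case
      using same[OF p_in y_in, of ?l] p min l len by auto
  qed
  have "p ! k = y k" if "k < N" for k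
  proof -
    have "N - Suc (N - Suc k) = k" "N - Suc k < N" using that by auto
    then show ?thesis using from_end[of "N - Suc k"] by simp
  qed
  then show "p = map y [0..<N]" using len by (intro nth_equalityI) auto
qed

lemma edge_succ_eq:
  assumes i: "i \<in> {1..r (Suc n)}" and p: "p \<in> P n i" and q: "q \<in> P n i" "p < q"
    and between: "\<And>s. s \<in> P n i \<Longrightarrow> \<not> (p < s \<and> s < q)"
  shows "edge_succ diagram pos_order (edg n i p) = edg n i q"
proof -
  let ?L = "\<lambda>a b. a \<noteq> b \<and> (a, b) \<in> pos_order (rng diagram (edg n i p))"
  have L: "?L (edg n i a) (edg n i b) \<longleftrightarrow> a < b" if "a \<in> P n i" "b \<in> P n i" for a b
    using that i by (auto simp: pos_order_def incoming_vtx)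
  have inc: "incoming diagram (rng diagram (edg n i p)) = edg n i ` P n i"
    using incoming_vtx[OF i] by simp
  show ?thesis
    unfolding edge_succ_def Let_def inc
  proof (rule the_equality)
    show "edg n i q \<in> edg n i ` P n i \<and> ?L (edg n i p) (edg n i q) \<and>
      (\<forall>g\<in>edg n i ` P n i. \<not> (?L (edg n i p) g \<and> ?L g (edg n i q)))"
      using q between L p by blast
  next
    fix e
    assume e: "e \<in> edg n i ` P n i \<and> ?L (edg n i p) e \<and>
      (\<forall>g\<in>edg n i ` P n i. \<not> (?L (edg n i p) g \<and> ?L g e))"
    then obtain s where s: "s \<in> P n i" "e = edg n i s" by blast
    then have "p < s" using e L p by blast
    moreover have "\<not> q < s"
    proof
      assume "q < s"
      then have "?L (edg n i p) (edg n i q)" "?L (edg n i q) e"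
        using L p q s by blast+
      then show False using e q(1) by blast
    qed
    ultimately have "s = q" using between[OF s(1)] by (meson linorder_neqE_nat)
    then show "e = edg n i q" using s(2) by simp
  qed
qed

text \<open>
The Vershik map as an odometer: the first \<open>N\<close> digits are maximal and turn minimal, digit \<open>N\<close>
moves to its successor, the rest is unchanged.
\<close>

lemma vershik_carry:
  assumes x: "x \<in> topspace (path_space diagram)" and y: "y \<in> topspace (path_space diagram)"
    and max: "\<And>n. n < N \<Longrightarrow> max_edge diagram pos_order (x n)"
    and notmax: "\<not> max_edge diagram pos_order (x N)"
    and min: "\<And>n. n < N \<Longrightarrow> min_edge diagram pos_order (y n)"
    and succ: "edge_succ diagram pos_order (x N) = y N"
    and same: "\<And>n. n > N \<Longrightarrow> y n = x n"
  shows "vershik_map diagram pos_order x = y"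
proof -
  have "\<not> max_path diagram pos_order x" using notmax by (auto simp: max_path_def)
  moreover have "(LEAST n. \<not> max_edge diagram pos_order (x n)) = N"
    using max notmax by (intro Least_equality) (auto simp: not_less[symmetric])
  ultimately show ?thesis
    using min_path_to_eq[OF y min refl] same
    by (simp add: vershik_map_def Let_def succ fun_eq_iff)
qed

end

section \<open>Circuits of a Gambaudo--Martens covering\<close>

locale gm_system =
  fixes G :: "nat \<Rightarrow> 'v graph" and \<phi> :: "nat \<Rightarrow> 'v \<Rightarrow> 'v" and v :: "nat \<Rightarrow> 'v"
    and r :: "nat \<Rightarrow> nat" and c :: "nat \<Rightarrow> nat \<Rightarrow> 'v list"
  assumes gm: "gm_covering G \<phi> v r c"
begin

text \<open>
The covering specifies circuits for positive levels only.  Level 0 gets the single loop at its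
vertex as its only circuit, so that all facts below hold on every level.
\<close>

definition rk :: "nat \<Rightarrow> nat" where
  "rk n = (if n = 0 then 1 else r n)"

definition circ :: "nat \<Rightarrow> nat \<Rightarrow> nat \<Rightarrow> 'v" where
  "circ n i j = (if n = 0 then v 0 else c n i ! j)"

definition len :: "nat \<Rightarrow> nat \<Rightarrow> nat" where
  "len n i = (if n = 0 then 1 else circ_len (c n i))"

lemma covering: "graph_covering G \<phi>"
  using gm by (simp add: gm_covering_def)

lemma graph_G: "is_graph (G n)"
  using covering by (simp add: graph_covering_def)

lemma cover: "graph_cover (G (Suc n)) (G n) (\<phi> (Suc n))"
  using covering by (simp add: graph_covering_def)

lemma verts_0: "verts (G 0) = {v 0}"
  using gm by (simp add: gm_covering_def)

lemma edges_0: "edges (G 0) = {(v 0, v 0)}"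
  using covering verts_0 by (auto simp: graph_covering_def)

lemma edge_verts: "(u, w) \<in> edges (G n) \<Longrightarrow> u \<in> verts (G n) \<and> w \<in> verts (G n)"
  using graph_G[of n] by (auto simp: is_graph_def)

lemma hom_edge: "(u, w) \<in> edges (G (Suc n)) \<Longrightarrow> (\<phi> (Suc n) u, \<phi> (Suc n) w) \<in> edges (G n)"
  using cover[of n] by (auto simp: graph_cover_def graph_hom_def)

lemma edge_lift:
  assumes "(u, w) \<in> edges (G n)"
  shows "\<exists>u' w'. (u', w') \<in> edges (G (Suc n)) \<and> \<phi> (Suc n) u' = u \<and> \<phi> (Suc n) w' = w"
proof -
  have "(u, w) \<in> map_prod (\<phi> (Suc n)) (\<phi> (Suc n)) ` edges (G (Suc n))"
    using cover[of n] assms by (simp add: graph_cover_def edge_surjective_def)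
  then show ?thesis by auto
qed

lemma hom_directional:
  "(u, w) \<in> edges (G (Suc n)) \<Longrightarrow> (u, w') \<in> edges (G (Suc n)) \<Longrightarrow> \<phi> (Suc n) w = \<phi> (Suc n) w'"
  using cover[of n] unfolding graph_cover_def plus_directional_def by blast

lemma gm_level:
  assumes "n > 0"
  shows "v n \<in> verts (G n)"
    and "\<And>i. i \<in> {1..r n} \<Longrightarrow> circuit (G n) (c n i) \<and> hd (c n i) = v n"
    and "inj_on (c n) {1..r n}"
    and "(\<Union>i\<in>{1..r n}. walk_edges (c n i)) = edges (G n)"
    and "\<And>i i' j j'. i \<in> {1..r n} \<Longrightarrow> i' \<in> {1..r n} \<Longrightarrow> j \<in> {1..circ_len (c n i)} \<Longrightarrow>
          j' \<in> {1..circ_len (c n i')} \<Longrightarrow> c n i ! j = c n i' ! j' \<Longrightarrow>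
            (\<exists>k. j + k = circ_len (c n i) \<and> j' + k = circ_len (c n i') \<and>
                 (\<forall>m\<le>k. c n i ! (j + m) = c n i' ! (j' + m)))"
    and "\<phi> n (v n) = v (n - 1)"
    and "\<And>i. i \<in> {1..r n} \<Longrightarrow> \<phi> n (c n i ! 1) = c (n - 1) 1 ! 1"
  using gm assms unfolding gm_covering_def by simp_all

lemma v_in: "v n \<in> verts (G n)"
  using gm_level(1)[of n] verts_0 by (cases "n = 0") auto

lemma c_list:
  assumes "n > 0" "i \<in> {1..r n}"
  shows "length (c n i) = Suc (circ_len (c n i))" "1 \<le> circ_len (c n i)"
    "c n i ! 0 = v n" "c n i ! circ_len (c n i) = v n" "distinct (butlast (c n i))"
proof -
  have c: "circuit (G n) (c n i)" "hd (c n i) = v n" using gm_level(2)[OF assms] by auto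
  then have len: "length (c n i) \<ge> 2" and ne: "c n i \<noteq> []" by (auto simp: circuit_def)
  then show "length (c n i) = Suc (circ_len (c n i))" "1 \<le> circ_len (c n i)"
    by (auto simp: circ_len_def)
  show "c n i ! 0 = v n" using c(2) ne by (simp add: hd_conv_nth)
  show "c n i ! circ_len (c n i) = v n"
    using c ne by (simp add: circuit_def circ_len_def last_conv_nth)
  show "distinct (butlast (c n i))" using c by (simp add: circuit_def)
qed

lemma len_pos:
  assumes "i \<in> {1..rk n}"
  shows "1 \<le> len n i"
  using assms c_list(2)[of n i] by (auto simp: len_def rk_def)

lemma circ_0:
  assumes "i \<in> {1..rk n}"
  shows "circ n i 0 = v n"
  using assms c_list(3)[of n i] by (auto simp: circ_def rk_def)

lemma circ_len_end:
  assumes "i \<in> {1..rk n}"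
  shows "circ n i (len n i) = v n"
  using assms c_list(4)[of n i] by (auto simp: circ_def rk_def len_def)

lemma circ_inner:
  assumes "i \<in> {1..rk n}" "0 < j" "j < len n i"
  shows "circ n i j \<noteq> v n"
proof -
  have n: "n > 0" using assms by (cases n) (auto simp: len_def)
  then have i: "i \<in> {1..r n}" and j: "j < circ_len (c n i)" using assms by (auto simp: rk_def len_def)
  note l = c_list[OF n i]
  have "butlast (c n i) ! 0 \<noteq> butlast (c n i) ! j"
    using l j assms(2) by (simp add: nth_eq_iff_index_eq)
  then have "c n i ! 0 \<noteq> c n i ! j" using l j by (simp add: nth_butlast)
  then show ?thesis using l n by (simp add: circ_def)
qed

lemma circ_edge:
  assumes "i \<in> {1..rk n}" "j < len n i"
  shows "(circ n i j, circ n i (Suc j)) \<in> edges (G n)"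
proof (cases "n = 0")
  case True
  then show ?thesis by (simp add: circ_def edges_0)
next
  case False
  then have n: "n > 0" and i: "i \<in> {1..r n}" using assms by (auto simp: rk_def)
  then show ?thesis
    using gm_level(2)[OF n i] c_list(1)[OF n i] assms(2)
    by (auto simp: circuit_def walk_def circ_def len_def)
qed

lemma edge_in_circ:
  assumes "(u, w) \<in> edges (G n)"
  shows "\<exists>i\<in>{1..rk n}. \<exists>j<len n i. u = circ n i j \<and> w = circ n i (Suc j)"
proof (cases "n = 0")
  case True
  then show ?thesis using assms by (auto simp: circ_def edges_0 len_def rk_def)
next
  case False
  then have n: "n > 0" by simp
  then obtain i where i: "i \<in> {1..r n}" "(u, w) \<in> walk_edges (c n i)"
    using assms gm_level(4)[OF n] by blast
  then obtain j where j: "Suc j < length (c n i)" "u = c n i ! j" "w = c n i ! Suc j"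
    by (auto simp: walk_edges_def)
  moreover have "j < len n i" using j c_list(1)[OF n i(1)] n by (simp add: len_def)
  ultimately show ?thesis using i(1) n by (auto simp: rk_def circ_def)
qed

lemma circ_merge:
  assumes "i \<in> {1..rk n}" "i' \<in> {1..rk n}" "1 \<le> j" "j \<le> len n i" "1 \<le> j'" "j' \<le> len n i'"
    and "circ n i j = circ n i' j'"
  shows "\<exists>k. j + k = len n i \<and> j' + k = len n i' \<and> (\<forall>m\<le>k. circ n i (j + m) = circ n i' (j' + m))"
proof (cases "n = 0")
  case True
  then show ?thesis using assms by (auto simp: circ_def len_def)
next
  case False
  then show ?thesis
    using gm_level(5)[of n i i' j j'] assms by (simp add: circ_def len_def rk_def)
qed

lemma circ_1_inject:
  assumes "i \<in> {1..rk n}" "i' \<in> {1..rk n}" "circ n i 1 = circ n i' 1"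
  shows "i = i'"
proof (cases "n = 0")
  case True
  then show ?thesis using assms by (simp add: rk_def)
next
  case False
  then have n: "n > 0" and i: "i \<in> {1..r n}" "i' \<in> {1..r n}" using assms by (auto simp: rk_def)
  obtain k where k: "1 + k = len n i" "1 + k = len n i'"
    "\<And>m. m \<le> k \<Longrightarrow> circ n i (1 + m) = circ n i' (1 + m)"
    using circ_merge[OF assms(1,2), of 1 1] assms len_pos by auto
  have "c n i = c n i'"
  proof (rule nth_equalityI)
    show "length (c n i) = length (c n i')"
      using c_list(1)[OF n i(1)] c_list(1)[OF n i(2)] k n by (simp add: len_def)
  next
    fix j assume "j < length (c n i)"
    then have "j \<le> 1 + k" using c_list(1)[OF n i(1)] k n by (simp add: len_def)
    then show "c n i ! j = c n i' ! j"
      using k(3)[of "j - 1"] c_list(3)[OF n i(1)] c_list(3)[OF n i(2)] n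
      by (cases j) (auto simp: circ_def)
  qed
  then show ?thesis using gm_level(3)[OF n] i by (auto dest: inj_onD)
qed

lemma \<phi>_v: "\<phi> (Suc n) (v (Suc n)) = v n"
  using gm_level(6)[of "Suc n"] by simp

lemma \<phi>_circ_1:
  assumes "i \<in> {1..rk (Suc n)}"
  shows "\<phi> (Suc n) (circ (Suc n) i 1) = circ n 1 1"
  using gm_level(7)[of "Suc n" i] assms gm by (auto simp: circ_def rk_def gm_covering_def)

lemma rk_pos: "1 \<le> rk n"
proof -
  obtain w where "(v n, w) \<in> edges (G n)"
    using v_in[of n] graph_G[of n] by (auto simp: is_graph_def)
  then show ?thesis using edge_in_circ by fastforce
qed

lemma one_in_rk: "1 \<in> {1..rk n}"
  using rk_pos by simp

text \<open>
Branching of the graph happens at the base vertex only: inside a circuit there is exactly one way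
to continue.
\<close>

lemma follow:
  assumes "(u, w) \<in> edges (G n)" "i \<in> {1..rk n}" "0 < j" "j < len n i" "u = circ n i j"
  shows "w = circ n i (Suc j)"
proof -
  obtain i' j' where i': "i' \<in> {1..rk n}" "j' < len n i'" "u = circ n i' j'" "w = circ n i' (Suc j')"
    using edge_in_circ[OF assms(1)] by blast
  have "0 < j'" using circ_inner[OF assms(2-4)] circ_0[OF i'(1)] assms(5) i'(3) by (cases j') auto
  then obtain k where k: "j + k = len n i" "\<And>m. m \<le> k \<Longrightarrow> circ n i (j + m) = circ n i' (j' + m)"
    using circ_merge[OF assms(2) i'(1), of j j'] assms i' by auto
  show ?thesis using k(2)[of 1] k(1) assms(4) i'(4) by simp
qed

lemma start:
  assumes "(v n, w) \<in> edges (G n)"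
  shows "\<exists>i\<in>{1..rk n}. w = circ n i 1"
proof -
  obtain i j where i: "i \<in> {1..rk n}" "j < len n i" "v n = circ n i j" "w = circ n i (Suc j)"
    using edge_in_circ[OF assms(1)] by blast
  then have "j = 0" using circ_inner[of i n j] by (cases j) auto
  then show ?thesis using i by auto
qed

text \<open>
The circuit that is entered when \<open>w\<close> follows the base vertex; circuits with the same first step are equal.
\<close>

definition idx :: "nat \<Rightarrow> 'v \<Rightarrow> nat" where
  "idx n w = (THE i. i \<in> {1..rk n} \<and> circ n i 1 = w)"

lemma idx_circ [simp]: "i \<in> {1..rk n} \<Longrightarrow> idx n (circ n i 1) = i"
  unfolding idx_def by (rule the_equality) (use circ_1_inject in blast)+

lemma idx_edge:
  assumes "(v n, w) \<in> edges (G n)"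
  shows "idx n w \<in> {1..rk n}" "w = circ n (idx n w) 1"
proof -
  obtain i where i: "i \<in> {1..rk n}" "w = circ n i 1" using start[OF assms] by blast
  then show "idx n w \<in> {1..rk n}" "w = circ n (idx n w) 1"
    by (simp_all only: idx_circ)
qed

lemma walk_reads_circ:
  assumes w: "\<And>j. j < L \<Longrightarrow> (w j, w (Suc j)) \<in> edges (G n)"
    and start: "w 0 = v n" "w 1 = circ n i 1" and i: "i \<in> {1..rk n}"
    and j: "j \<le> L" "j \<le> len n i"
  shows "w j = circ n i j"
  using j
proof (induction j)
  case 0
  then show ?case using start circ_0[OF i] by simp
next
  case (Suc j)
  show ?case
  proof (cases "j = 0")
    case True
    then show ?thesis using start by simp
  next
    case False
    have "(w j, w (Suc j)) \<in> edges (G n)" using w Suc.prems by auto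
    then show ?thesis by (rule follow[OF _ i]) (use Suc False in auto)
  qed
qed

subsection \<open>The circuit diagram with rotated even levels\<close>

definition pcirc :: "nat \<Rightarrow> nat \<Rightarrow> nat \<Rightarrow> 'v" where
  "pcirc n i j = \<phi> (Suc n) (circ (Suc n) i j)"

context
  fixes n i assumes i: "i \<in> {1..rk (Suc n)}"
begin

lemma pcirc_0: "pcirc n i 0 = v n"
  using circ_0[OF i] \<phi>_v by (simp add: pcirc_def)

lemma pcirc_1: "pcirc n i 1 = circ n 1 1"
  using \<phi>_circ_1[OF i] by (simp add: pcirc_def)

lemma pcirc_len: "pcirc n i (len (Suc n) i) = v n"
  using circ_len_end[OF i] \<phi>_v by (simp add: pcirc_def)

lemma pcirc_edge: "j < len (Suc n) i \<Longrightarrow> (pcirc n i j, pcirc n i (Suc j)) \<in> edges (G n)"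
  using circ_edge[OF i] hom_edge by (simp add: pcirc_def)

text \<open>
Splitting of the projected circuit into circuits of $G_n$: a piece that begins at a visit of the
base vertex must be completed, since the projected walk ends in the base vertex and an unfinished
piece would meet it in its interior.
\<close>

lemma pcirc_reads:
  assumes p: "p < len (Suc n) i" "pcirc n i p = v n"
  defines "j \<equiv> idx n (pcirc n i (Suc p))"
  shows "j \<in> {1..rk n}" "p + len n j \<le> len (Suc n) i"
    "\<And>t. t \<le> len n j \<Longrightarrow> pcirc n i (p + t) = circ n j t"
proof -
  have e: "(v n, pcirc n i (Suc p)) \<in> edges (G n)" using pcirc_edge[OF p(1)] p(2) by simp
  show j: "j \<in> {1..rk n}" using idx_edge[OF e] by (simp add: j_def)
  have read: "pcirc n i (p + t) = circ n j t" if "t \<le> len (Suc n) i - p" "t \<le> len n j" for t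
    by (rule walk_reads_circ[where L = "len (Suc n) i - p" and w = "\<lambda>t. pcirc n i (p + t)"])
      (use that p j idx_edge[OF e] pcirc_edge in \<open>auto simp: j_def\<close>)
  show le: "p + len n j \<le> len (Suc n) i"
  proof (rule ccontr)
    assume "\<not> ?thesis"
    then have "len (Suc n) i - p < len n j" using p by simp
    moreover from this have "circ n j (len (Suc n) i - p) = v n"
      using read[of "len (Suc n) i - p"] p pcirc_len by simp
    ultimately show False using circ_inner[OF j] p by auto
  qed
  show "\<And>t. t \<le> len n j \<Longrightarrow> pcirc n i (p + t) = circ n j t"
    using read le by simp
qed

lemma pcirc_begins:
  shows "len n 1 \<le> len (Suc n) i" "t \<le> len n 1 \<Longrightarrow> pcirc n i t = circ n 1 t"
proof -
  have "idx n (pcirc n i (Suc 0)) = 1" using pcirc_1 idx_circ[OF one_in_rk] by simp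
  then show "len n 1 \<le> len (Suc n) i" "t \<le> len n 1 \<Longrightarrow> pcirc n i t = circ n 1 t"
    using pcirc_reads[of 0] len_pos[OF i] pcirc_0 by auto
qed

end

definition \<delta> :: "nat \<Rightarrow> nat" where
  "\<delta> n = (if even n then len n 1 else 0)"

text \<open>
The edges into circuit \<open>i\<close> are the visits of its projection to the base vertex.  For odd
\<open>n\<close> the final visit, at time \<open>len (Suc n) i\<close>, is omitted: these are the starting times of the pieces.
For even \<open>n\<close> the initial visit is omitted and the final one stands for the piece $c_{n,1}$ with which
the next circuit begins, whichever that is.  The times below \<open>\<delta> n\<close> are thereby handed to the end, so the
pieces tile the interval from \<open>\<delta> n\<close> to \<open>len (Suc n) i + \<delta> n\<close>.
\<close>

definition P :: "nat \<Rightarrow> nat \<Rightarrow> nat set" where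
  "P n i = {p. pcirc n i p = v n \<and>
     (if even n then 0 < p \<and> p \<le> len (Suc n) i else p < len (Suc n) i)}"

definition S :: "nat \<Rightarrow> nat \<Rightarrow> nat \<Rightarrow> nat" where
  "S n i p = (if p = len (Suc n) i then 1 else idx n (pcirc n i (Suc p)))"

lemma P_le: "p \<in> P n i \<Longrightarrow> p \<le> len (Suc n) i"
  by (auto simp: P_def split: if_splits)

lemma finite_P: "finite (P n i)"
  using P_le by (auto intro: finite_subset[of _ "{..len (Suc n) i}"])

lemma S_in_rk:
  assumes "i \<in> {1..rk (Suc n)}" "p \<in> P n i"
  shows "S n i p \<in> {1..rk n}"
  using assms pcirc_reads(1)[OF assms(1), of p] one_in_rk P_le[OF assms(2)]
  by (auto simp: P_def S_def simp del: One_nat_def)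

lemma P_bounds:
  assumes i: "i \<in> {1..rk (Suc n)}" and p: "p \<in> P n i"
  shows "\<delta> n \<le> p" "p < len (Suc n) i + \<delta> n"
proof -
  show "\<delta> n \<le> p"
  proof (cases "even n")
    case True
    then have "0 < p" "pcirc n i p = v n" using p by (auto simp: P_def)
    then have "\<not> p < len n 1"
      using pcirc_begins(2)[OF i, of p] circ_inner[OF one_in_rk, of p n] by auto
    then show ?thesis using True by (simp add: \<delta>_def)
  qed (simp add: \<delta>_def)
  show "p < len (Suc n) i + \<delta> n"
    using p len_pos[OF one_in_rk, of n] by (auto simp: P_def \<delta>_def split: if_splits)
qed

lemma \<delta>_in_P:
  assumes i: "i \<in> {1..rk (Suc n)}"
  shows "\<delta> n \<in> P n i"
proof (cases "even n")
  case True
  then show ?thesis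
    using pcirc_begins[OF i] circ_len_end[OF one_in_rk] len_pos[OF one_in_rk, of n]
    by (auto simp: P_def \<delta>_def)
next
  case False
  then show ?thesis using pcirc_0[OF i] len_pos[OF i] by (simp add: P_def \<delta>_def)
qed

lemma Min_P: "i \<in> {1..rk (Suc n)} \<Longrightarrow> Min (P n i) = \<delta> n"
  using \<delta>_in_P P_bounds finite_P by (intro Min_eqI) auto

text \<open>
The tiling: the piece at position \<open>p\<close> has length \<open>len n (S n i p)\<close>, and it ends either where the
next piece starts or at the right end of the interval.
\<close>

lemma next_position:
  assumes i: "i \<in> {1..rk (Suc n)}" and p: "p \<in> P n i"
  defines "q \<equiv> p + len n (S n i p)"
  shows "q \<le> len (Suc n) i + \<delta> n"
    and "q < len (Suc n) i + \<delta> n \<Longrightarrow> q \<in> P n i"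
    and "s \<in> P n i \<Longrightarrow> \<not> (p < s \<and> s < q)"
    and "p = Max (P n i) \<longleftrightarrow> q = len (Suc n) i + \<delta> n"
proof -
  let ?L = "len (Suc n) i"
  have all: "q \<le> ?L + \<delta> n \<and> (q < ?L + \<delta> n \<longrightarrow> q \<in> P n i) \<and> (\<forall>s\<in>P n i. \<not> (p < s \<and> s < q))"
  proof (cases "p = ?L")
    case True
    then have "even n" using p by (auto simp: P_def split: if_splits)
    then show ?thesis using True P_le by (auto simp: q_def S_def \<delta>_def not_less)
  next
    case False
    then have pL: "p < ?L" using P_le[OF p] by simp
    have pv: "pcirc n i p = v n" using p by (simp add: P_def)
    have S: "S n i p = idx n (pcirc n i (Suc p))" using False by (simp add: S_def)
    note rd = pcirc_reads[OF i pL pv, folded S]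
    have qL: "q \<le> ?L" using rd(2) by (simp add: q_def)
    have "pcirc n i q = v n" using rd(3)[of "len n (S n i p)"] circ_len_end[OF rd(1)] by (simp add: q_def)
    moreover have "0 < q" using len_pos[OF rd(1)] by (simp add: q_def)
    ultimately have "q < ?L + \<delta> n \<longrightarrow> q \<in> P n i" using qL by (auto simp: P_def \<delta>_def)
    moreover have "\<not> (p < s \<and> s < q)" if "s \<in> P n i" for s
    proof
      assume "p < s \<and> s < q"
      then have "0 < s - p" "s - p < len n (S n i p)" "p + (s - p) = s" by (auto simp: q_def)
      then show False
        using circ_inner[OF rd(1), of "s - p"] rd(3)[of "s - p"] that by (simp add: P_def)
    qed
    ultimately show ?thesis using qL by auto
  qed
  then show "q \<le> ?L + \<delta> n" "q < ?L + \<delta> n \<Longrightarrow> q \<in> P n i"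
    "s \<in> P n i \<Longrightarrow> \<not> (p < s \<and> s < q)" by auto
  have pq: "p < q" using len_pos[OF S_in_rk[OF i p]] by (simp add: q_def)
  show "p = Max (P n i) \<longleftrightarrow> q = ?L + \<delta> n"
  proof
    assume "p = Max (P n i)"
    then have "q \<notin> P n i" using pq finite_P Max_ge[of "P n i" q] by (metis not_less)
    then show "q = ?L + \<delta> n" using all by auto
  next
    assume q: "q = ?L + \<delta> n"
    then have "s \<le> p" if "s \<in> P n i" for s
      using all P_bounds(2)[OF i that] that by (meson not_less)
    then show "p = Max (P n i)" using p finite_P by (intro Max_eqI[symmetric]) auto
  qed
qed

text \<open>
Rotation does not change the set of pieces: the piece at time 0, lost on even levels, is $c_{n,1}$
and reappears at the end.
\<close>

lemma occurs:
  assumes i: "i \<in> {1..rk (Suc n)}" and p: "p < len (Suc n) i" "pcirc n i p = v n"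
  shows "\<exists>p'\<in>P n i. S n i p' = idx n (pcirc n i (Suc p))"
proof (cases "even n \<and> p = 0")
  case True
  then have "idx n (pcirc n i (Suc p)) = 1" using pcirc_1[OF i] idx_circ[OF one_in_rk] by simp
  then show ?thesis
    using True p pcirc_len[OF i] by (intro bexI[of _ "len (Suc n) i"]) (auto simp: S_def P_def)
next
  case False
  then show ?thesis using p by (intro bexI[of _ p]) (auto simp: S_def P_def)
qed

sublocale position_diagram rk P S
proof
  show "rk 0 = 1" by (simp add: rk_def)
  show "1 \<le> rk n" for n by (rule rk_pos)
  show "finite (P n i)" for n i by (rule finite_P)
  show "P n i \<noteq> {}" if "i \<in> {1..rk (Suc n)}" for n i using \<delta>_in_P[OF that] by auto
  show "S n i p \<in> {1..rk n}" if "i \<in> {1..rk (Suc n)}" "p \<in> P n i" for n i p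
    using S_in_rk[OF that] .
  show "\<exists>i\<in>{1..rk (Suc n)}. \<exists>p\<in>P n i. S n i p = j" if j: "j \<in> {1..rk n}" for n j
  proof -
    have "(v n, circ n j 1) \<in> edges (G n)" using circ_edge[OF j, of 0] circ_0[OF j] len_pos[OF j] by simp
    then obtain u w where uw: "(u, w) \<in> edges (G (Suc n))" "\<phi> (Suc n) u = v n" "\<phi> (Suc n) w = circ n j 1"
      using edge_lift by blast
    then obtain i p where i: "i \<in> {1..rk (Suc n)}" "p < len (Suc n) i" "u = circ (Suc n) i p"
      "w = circ (Suc n) i (Suc p)" using edge_in_circ[OF uw(1)] by blast
    then show ?thesis
      using occurs[OF i(1,2)] uw(2,3) idx_circ[OF j] by (intro bexI[OF _ i(1)]) (simp add: pcirc_def)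
  qed
qed

text \<open>
Traces a traversal of $c_{n,j}$ inside the projection of $c_{m,i}$ through the levels between: on
the level below \<open>m\<close>, the time \<open>p\<close> belongs to the piece that starts at the last visit before it.
\<close>

lemma connected_if_visits:
  assumes "n \<le> m" "i \<in> {1..rk m}" "p < len m i" "j \<in> {1..rk n}"
    "comp_cover \<phi> m n (circ m i p) = v n" "comp_cover \<phi> m n (circ m i (Suc p)) = circ n j 1"
  shows "\<exists>I q. I n = j \<and> I m = i \<and> (\<forall>k\<in>{n..<m}. I (Suc k) \<in> {1..rk (Suc k)} \<and>
        q k \<in> P k (I (Suc k)) \<and> S k (I (Suc k)) (q k) = I k)"
  using assms
proof (induction m arbitrary: i p rule: dec_induct)
  case base
  have id: "comp_cover \<phi> n n = id" by (cases n) auto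
  then have "p = 0" using base circ_inner[of i n p] by (cases p) auto
  then have "i = j" using base id circ_1_inject by auto
  then show ?case by auto
next
  case (step m)
  note i = step.prems(1)
  have comp: "comp_cover \<phi> (Suc m) n (circ (Suc m) i t) = comp_cover \<phi> m n (pcirc m i t)" for t
    using step.hyps by (simp add: pcirc_def)
  \<comment> \<open>the start of the piece that contains the time \<open>p\<close>\<close>
  define q where "q = (GREATEST q. q \<le> p \<and> pcirc m i q = v m)"
  have q: "q \<le> p \<and> pcirc m i q = v m"
    unfolding q_def by (rule GreatestI_nat[where k = 0 and b = p]) (use pcirc_0[OF i] in auto)
  have q_max: "t \<le> q" if "t \<le> p" "pcirc m i t = v m" for t
    unfolding q_def by (rule Greatest_le_nat[where b = p]) (use that in auto)
  have qL: "q < len (Suc m) i" using q step.prems by simp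
  define l where "l = idx m (pcirc m i (Suc q))"
  note rd = pcirc_reads[OF i qL conjunct2[OF q], folded l_def]
  have pq: "p < q + len m l"
  proof (rule ccontr)
    assume "\<not> ?thesis"
    then have "q + len m l \<le> q"
      using q_max[of "q + len m l"] rd(3)[of "len m l"] circ_len_end[OF rd(1)] by auto
    then show False using len_pos[OF rd(1)] by simp
  qed
  have "\<exists>I q. I n = j \<and> I m = l \<and> (\<forall>k\<in>{n..<m}. I (Suc k) \<in> {1..rk (Suc k)} \<and>
        q k \<in> P k (I (Suc k)) \<and> S k (I (Suc k)) (q k) = I k)"
  proof (rule step.IH[OF rd(1)])
    show "p - q < len m l" using pq q len_pos[OF rd(1)] by linarith
    show "j \<in> {1..rk n}" by fact
    show "comp_cover \<phi> m n (circ m l (p - q)) = v n"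
      using rd(3)[of "p - q"] pq q step.prems(4) comp[of p] by simp
    show "comp_cover \<phi> m n (circ m l (Suc (p - q))) = circ n j 1"
    proof -
      have "Suc (p - q) \<le> len m l" "q + Suc (p - q) = Suc p" using pq q by auto
      then have "circ m l (Suc (p - q)) = pcirc m i (Suc p)" using rd(3) by metis
      then show ?thesis using step.prems(5) comp by metis
    qed
  qed
  then obtain I t where I: "I n = j" "I m = l" "\<And>k. k \<in> {n..<m} \<Longrightarrow> I (Suc k) \<in> {1..rk (Suc k)} \<and>
        t k \<in> P k (I (Suc k)) \<and> S k (I (Suc k)) (t k) = I k" by blast
  obtain p' where p': "p' \<in> P m i" "S m i p' = l"
    using occurs[OF i qL conjunct2[OF q]] by (auto simp: l_def)
  have "(I(Suc m := i)) (Suc k) \<in> {1..rk (Suc k)} \<and>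
        (t(m := p')) k \<in> P k ((I(Suc m := i)) (Suc k)) \<and>
        S k ((I(Suc m := i)) (Suc k)) ((t(m := p')) k) = (I(Suc m := i)) k"
    if "k \<in> {n..<Suc m}" for k
    using that I(2) I(3)[of k] p' i by (cases "k = m") auto
  moreover have "(I(Suc m := i)) n = j" using I(1) step.hyps by simp
  ultimately show ?case
    by (intro exI[of _ "I(Suc m := i)"] exI[of _ "t(m := p')"]) simp
qed

lemma properly_ordered_diagram:
  assumes "gm_simple G \<phi> r c"
  shows "properly_ordered diagram pos_order"
proof (rule properly_orderedI)
  show "simple_bratteli diagram"
  proof (rule simple_diagramI)
    fix n :: nat assume n: "n > 0"
    then obtain m where m_n: "m > n"
      and m_all: "\<forall>i\<in>{1..r m}. walk_edges (map (comp_cover \<phi> m n) (c m i)) = edges (G n)"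
      using assms unfolding gm_simple_def by meson
    note m = m_n bspec[OF m_all]
    show "\<exists>m>n. \<forall>j\<in>{1..rk n}. \<forall>i\<in>{1..rk m}.
       \<exists>I p. I n = j \<and> I m = i \<and> (\<forall>k\<in>{n..<m}. I (Suc k) \<in> {1..rk (Suc k)} \<and>
        p k \<in> P k (I (Suc k)) \<and> S k (I (Suc k)) (p k) = I k)"
    proof (intro exI[of _ m] conjI ballI m(1))
      fix j i assume j: "j \<in> {1..rk n}" and i: "i \<in> {1..rk m}"
      then have i': "i \<in> {1..r m}" using m(1) by (simp add: rk_def)
      have "(v n, circ n j 1) \<in> edges (G n)"
        using circ_edge[OF j, of 0] circ_0[OF j] len_pos[OF j] by simp
      then have "(v n, circ n j 1) \<in> walk_edges (map (comp_cover \<phi> m n) (c m i))"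
        using m(2)[OF i'] by simp
      then obtain p where p: "Suc p < length (c m i)" "v n = comp_cover \<phi> m n (c m i ! p)"
        "circ n j 1 = comp_cover \<phi> m n (c m i ! Suc p)"
        unfolding walk_edges_def by (auto simp: nth_map)
      then show "\<exists>I p. I n = j \<and> I m = i \<and> (\<forall>k\<in>{n..<m}. I (Suc k) \<in> {1..rk (Suc k)} \<and>
        p k \<in> P k (I (Suc k)) \<and> S k (I (Suc k)) (p k) = I k)"
        using connected_if_visits[of n m i p j] m(1) i j c_list(1)[of m i] i'
        by (simp add: circ_def len_def)
    qed
  qed
next
  fix n i assume n: "even n" and i: "i \<in> {1..rk (Suc n)}"
  have "len (Suc n) i \<in> P n i" using n pcirc_len[OF i] len_pos[OF i] by (simp add: P_def)
  then have "Max (P n i) = len (Suc n) i" using finite_P P_le by (intro Max_eqI) auto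
  then show "S n i (Max (P n i)) = 1" by (simp add: S_def)
next
  fix n i assume n: "odd n" and i: "i \<in> {1..rk (Suc n)}"
  then have "Min (P n i) = 0" using Min_P[OF i] by (simp add: \<delta>_def)
  then show "S n i (Min (P n i)) = 1"
    using pcirc_1[OF i] idx_circ[OF one_in_rk, of n] len_pos[OF i] by (simp add: S_def)
qed

lemma bratteli_rank_diagram: "bratteli_rank diagram = gm_rank r"
  unfolding bratteli_rank_def gm_rank_def
proof (rule Liminf_eq)
  have "card (bverts diagram n) = r n" if "n > 0" for n
    using that by (simp add: card_image inj_on_def rk_def)
  then show "\<forall>\<^sub>F n in sequentially. enat (card (bverts diagram n)) = enat (r n)"
    unfolding eventually_sequentially by (intro exI[of _ 1]) simp
qed

end


section \<open>Bi-infinite orbits as arrays and their itineraries\<close>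

context gm_system
begin

text \<open>
The bi-infinite orbits of the inverse limit, written out in coordinates: \<open>a k n\<close> is the vertex of
$G_n$ that the orbit occupies at time \<open>k\<close>.
\<close>

definition arrays :: "(int \<Rightarrow> nat \<Rightarrow> 'v) set" where
  "arrays = {a. (\<forall>k n. (a k n, a (k + 1) n) \<in> edges (G n)) \<and>
                (\<forall>k n. a k n = \<phi> (Suc n) (a k (Suc n)))}"

text \<open>
The orbit is observed at time $-m_n$ on level $n$.  The circuit traversed there is \<open>tower n a\<close>, and
\<open>age n a\<close> is the time since it was entered.  Looking further back on higher levels is what
makes the past of the orbit visible.
\<close>

definition offset :: "nat \<Rightarrow> int" where
  "offset n = (\<Sum>j<n. int (\<delta> j))"

definition age :: "nat \<Rightarrow> (int \<Rightarrow> nat \<Rightarrow> 'v) \<Rightarrow> nat" where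
  "age n a = (LEAST d. a (- offset n - int d) n = v n)"

definition tower :: "nat \<Rightarrow> (int \<Rightarrow> nat \<Rightarrow> 'v) \<Rightarrow> nat" where
  "tower n a = idx n (a (- offset n - int (age n a) + 1) n)"

lemma offset_Suc: "offset (Suc n) = offset n + int (\<delta> n)"
  by (simp add: offset_def)

lemma array_edge: "a \<in> arrays \<Longrightarrow> (a k n, a (k + 1) n) \<in> edges (G n)"
  unfolding arrays_def by blast

lemma array_proj: "a \<in> arrays \<Longrightarrow> a k n = \<phi> (Suc n) (a k (Suc n))"
  unfolding arrays_def by blast

lemma array_reads:
  assumes a: "a \<in> arrays" and "a k n = v n" "a (k + 1) n = circ n i 1"
    and "i \<in> {1..rk n}" "j \<le> len n i"
  shows "a (k + int j) n = circ n i j"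
proof (rule walk_reads_circ[where L = "len n i" and w = "\<lambda>j. a (k + int j) n"])
  fix j
  show "(a (k + int j) n, a (k + int (Suc j)) n) \<in> edges (G n)"
    using array_edge[OF a, of "k + int j" n] by (simp add: algebra_simps)
qed (use assms in auto)

text \<open>
Every walk returns to the base vertex within the largest length \<open>M\<close> of a circuit.  Starting at
time \<open>k - M\<close>, the rest of the circuit traversed at that time is completed no later than \<open>k\<close>.
\<close>

lemma array_visits_base:
  assumes a: "a \<in> arrays"
  shows "\<exists>d. a (k - int d) n = v n"
proof -
  define M where "M = Max (len n ` {1..rk n})"
  let ?k = "k - int M"
  obtain i j where i: "i \<in> {1..rk n}" "j < len n i" "a ?k n = circ n i j" "a (?k + 1) n = circ n i (Suc j)"
    using edge_in_circ[OF array_edge[OF a, of ?k n]] by blast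
  have "a (?k + int t) n = circ n i (j + t)" if "j + t \<le> len n i" for t
    using that
  proof (induction t)
    case 0
    then show ?case using i by simp
  next
    case (Suc t)
    show ?case
    proof (cases "t = 0")
      case True
      then show ?thesis using i by simp
    next
      case False
      have "(a (?k + int t) n, a (?k + int (Suc t)) n) \<in> edges (G n)"
        using array_edge[OF a, of "?k + int t" n] by (simp add: algebra_simps)
      then show ?thesis
        using follow[of "a (?k + int t) n" _ n i "j + t"] Suc False i by simp
    qed
  qed
  from this[of "len n i - j"] have "a (?k + int (len n i - j)) n = v n"
    using i circ_len_end by simp
  moreover have "len n i - j \<le> M"
    unfolding M_def using i(1) by (intro order.trans[OF diff_le_self] Max_ge) auto
  ultimately show ?thesis
    by (intro exI[of _ "M - (len n i - j)"]) (simp add: of_nat_diff algebra_simps)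
qed

lemma age_visit:
  assumes "a \<in> arrays"
  shows "a (- offset n - int (age n a)) n = v n"
  unfolding age_def by (rule LeastI_ex) (rule array_visits_base[OF assms])

lemma tower_circ:
  assumes a: "a \<in> arrays"
  shows "tower n a \<in> {1..rk n}" "a (- offset n - int (age n a) + 1) n = circ n (tower n a) 1"
proof -
  have "(v n, a (- offset n - int (age n a) + 1) n) \<in> edges (G n)"
    using array_edge[OF a] age_visit[OF a] by metis
  from idx_edge[OF this] show "tower n a \<in> {1..rk n}"
    "a (- offset n - int (age n a) + 1) n = circ n (tower n a) 1"
    by (simp_all add: tower_def)
qed

lemma array_at:
  assumes a: "a \<in> arrays" and j: "j \<le> len n (tower n a)"
  shows "a (- offset n - int (age n a) + int j) n = circ n (tower n a) j"
  using array_reads[OF a age_visit[OF a] tower_circ(2)[OF a] tower_circ(1)[OF a] j] .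

lemma age_less:
  assumes a: "a \<in> arrays"
  shows "age n a < len n (tower n a)"
proof (rule ccontr)
  let ?l = "len n (tower n a)"
  assume "\<not> ?thesis"
  then have l: "?l \<le> age n a" by simp
  have "a (- offset n - int (age n a - ?l)) n = v n"
    using array_at[OF a order_refl] circ_len_end[OF tower_circ(1)[OF a]] l
    by (simp add: of_nat_diff algebra_simps)
  then have "age n a \<le> age n a - ?l" unfolding age_def by (rule Least_le)
  then show False using l len_pos[OF tower_circ(1)[OF a, of n]] by linarith
qed

text \<open>
Age and circuit are read off from two entries of the array.  This gives both the continuity of the
itinerary and the means to construct arrays with prescribed ages.
\<close>

lemma age_tower_iff:
  assumes a: "a \<in> arrays" and i: "i \<in> {1..rk n}" and d: "d < len n i"
  shows "age n a = d \<and> tower n a = i \<longleftrightarrow>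
    a (- offset n - int d) n = v n \<and> a (- offset n - int d + 1) n = circ n i 1"
proof
  assume "age n a = d \<and> tower n a = i"
  then show "a (- offset n - int d) n = v n \<and> a (- offset n - int d + 1) n = circ n i 1"
    using age_visit[OF a, of n] tower_circ(2)[OF a, of n] by auto
next
  assume at: "a (- offset n - int d) n = v n \<and> a (- offset n - int d + 1) n = circ n i 1"
  have le: "age n a \<le> d" unfolding age_def using at by (intro Least_le) auto
  moreover have "\<not> age n a < d"
  proof
    assume less: "age n a < d"
    have "- offset n - int d + int (d - age n a) = - offset n - int (age n a)"
      using le by (simp add: of_nat_diff)
    then have "circ n i (d - age n a) = v n"
      using array_reads[OF a conjunct1[OF at] conjunct2[OF at] i, of "d - age n a"] d
        age_visit[OF a, of n] by simp
    then show False using circ_inner[OF i, of "d - age n a"] less d by simp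
  qed
  ultimately have age: "age n a = d" by simp
  then show "age n a = d \<and> tower n a = i"
    using at idx_circ[OF i] by (simp add: tower_def)
qed

text \<open>
The tower of level \<open>n + 1\<close> at age \<open>A\<close> has, seen from level \<open>n\<close>, read \<open>A + \<delta> n\<close> steps of the
projected circuit, because level \<open>n\<close> is observed \<open>\<delta> n\<close> steps later.  If this lies in the piece at
position \<open>p\<close>, that piece is the tower of level \<open>n\<close>.
\<close>

lemma age_tower_below:
  assumes a: "a \<in> arrays" and p: "p \<in> P n (tower (Suc n) a)"
    and D: "age (Suc n) a + \<delta> n = D + p" "D < len n (S n (tower (Suc n) a) p)"
  shows "age n a = D \<and> tower n a = S n (tower (Suc n) a) p"
proof -
  let ?i = "tower (Suc n) a"
  let ?t = "- offset (Suc n) - int (age (Suc n) a)"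
  note i = tower_circ(1)[OF a, of "Suc n"]
  have time: "- offset n - int D = ?t + int p" using D(1) by (simp add: offset_Suc)
  have pL: "p \<le> len (Suc n) ?i" using P_le[OF p] .
  have proj: "a (?t + int j) n = pcirc n ?i j" if "j \<le> len (Suc n) ?i" for j
    using array_proj[OF a, of "?t + int j" n] array_at[OF a that] by (simp add: pcirc_def)
  have visit: "a (?t + int p) n = v n" using proj[OF pL] p by (simp add: P_def)
  have "a (?t + int p + 1) n = circ n (S n ?i p) 1"
  proof (cases "p = len (Suc n) ?i")
    case True
    let ?k = "?t + int p"
    have "a ?k (Suc n) = v (Suc n)" using array_at[OF a pL] True circ_len_end[OF i] by simp
    then obtain i' where "i' \<in> {1..rk (Suc n)}" "a (?k + 1) (Suc n) = circ (Suc n) i' 1"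
      using array_edge[OF a, of ?k "Suc n"] start by metis
    then show ?thesis
      using array_proj[OF a, of "?k + 1" n] \<phi>_circ_1 True by (simp add: S_def)
  next
    case False
    then have "a (?t + int p + 1) n = pcirc n ?i (Suc p)"
      using proj[of "Suc p"] pL by (simp add: algebra_simps)
    moreover from this have "(v n, pcirc n ?i (Suc p)) \<in> edges (G n)"
      using array_edge[OF a, of "?t + int p" n] visit by simp
    ultimately show ?thesis using idx_edge(2) False by (simp add: S_def)
  qed
  then show ?thesis
    using age_tower_iff[OF a S_in_rk[OF i p] D(2)] time visit by simp
qed

text \<open>
The position of the current tower of level \<open>n\<close> inside that of level \<open>n + 1\<close>.  The time
\<open>age (Suc n) a + \<delta> n\<close> falls into exactly one piece of the tiling, whence the next lemma.
\<close>

definition position :: "nat \<Rightarrow> (int \<Rightarrow> nat \<Rightarrow> 'v) \<Rightarrow> nat" where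
  "position n a = age (Suc n) a + \<delta> n - age n a"

lemma position:
  assumes a: "a \<in> arrays"
  shows "age n a + position n a = age (Suc n) a + \<delta> n"
    and "position n a \<in> P n (tower (Suc n) a)"
    and "S n (tower (Suc n) a) (position n a) = tower n a"
proof -
  let ?i = "tower (Suc n) a" and ?D = "age (Suc n) a + \<delta> n"
  note i = tower_circ(1)[OF a, of "Suc n"]
  \<comment> \<open>the piece that contains the time \<open>?D\<close>\<close>
  define p where "p = Max {p \<in> P n ?i. p \<le> ?D}"
  have fin: "finite {p \<in> P n ?i. p \<le> ?D}" by simp
  have "\<delta> n \<in> {p \<in> P n ?i. p \<le> ?D}" using \<delta>_in_P[OF i] by simp
  then have p: "p \<in> P n ?i" "p \<le> ?D" using Max_in[OF fin] unfolding p_def by blast+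
  have "?D < p + len n (S n ?i p)"
  proof (rule ccontr)
    assume "\<not> ?thesis"
    then have le: "p + len n (S n ?i p) \<le> ?D" by simp
    then have "p + len n (S n ?i p) < len (Suc n) ?i + \<delta> n" using age_less[OF a, of "Suc n"] by simp
    then have "p + len n (S n ?i p) \<in> {p \<in> P n ?i. p \<le> ?D}"
      using next_position(2)[OF i p(1)] le by simp
    then have "p + len n (S n ?i p) \<le> p" unfolding p_def by (rule Max_ge[OF fin])
    then show False using len_pos[OF S_in_rk[OF i p(1)]] by simp
  qed
  then have "age n a = ?D - p" "tower n a = S n ?i p"
    using age_tower_below[OF a p(1), of "?D - p"] p(2) by auto
  moreover from this have "position n a = p" using p(2) by (simp add: position_def)
  ultimately show "age n a + position n a = ?D"
    "position n a \<in> P n ?i" "S n ?i (position n a) = tower n a"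
    using p by auto
qed

definition itinerary :: "(int \<Rightarrow> nat \<Rightarrow> 'v) \<Rightarrow> nat \<Rightarrow> nat" where
  "itinerary a n = edg n (tower (Suc n) a) (position n a)"

lemma itinerary_in_path_space:
  assumes a: "a \<in> arrays"
  shows "itinerary a \<in> topspace (path_space diagram)"
proof -
  have "itinerary a = (\<lambda>n. edg n (tower (Suc n) a) (position n a))" by (simp add: itinerary_def fun_eq_iff)
  then show ?thesis
    using path_of_coordinates[of "\<lambda>n. tower n a" "\<lambda>n. position n a",
        OF tower_circ(1)[OF a] position(2)[OF a] position(3)[OF a, symmetric]]
    by (simp only:)
qed

lemma shift_arrays: "a \<in> arrays \<Longrightarrow> shift a \<in> arrays"
  unfolding arrays_def shift_def by blast

lemma age_shift:
  assumes a: "a \<in> arrays"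
  shows "Suc (age n a) = len n (tower n a) \<Longrightarrow> age n (shift a) = 0"
    and "Suc (age n a) \<noteq> len n (tower n a) \<Longrightarrow>
      age n (shift a) = Suc (age n a) \<and> tower n (shift a) = tower n a"
proof -
  assume l: "Suc (age n a) = len n (tower n a)"
  have "a (- offset n - int (age n a) + int (len n (tower n a))) n = v n"
    using array_at[OF a order_refl] circ_len_end[OF tower_circ(1)[OF a]] by simp
  then have "shift a (- offset n - int 0) n = v n"
    unfolding l[symmetric] by (simp add: shift_def)
  then have "age n (shift a) \<le> 0" unfolding age_def by (rule Least_le)
  then show "age n (shift a) = 0" by simp
next
  assume "Suc (age n a) \<noteq> len n (tower n a)"
  then have "Suc (age n a) < len n (tower n a)" using age_less[OF a, of n] by simp
  from age_tower_iff[OF shift_arrays[OF a] tower_circ(1)[OF a] this]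
  show "age n (shift a) = Suc (age n a) \<and> tower n (shift a) = tower n a"
    using age_visit[OF a, of n] tower_circ(2)[OF a, of n]
    by (simp add: shift_def algebra_simps)
qed

text \<open>
The time until the current tower of level \<open>n\<close> is left.  It starts with 1 on level 0 and does not
decrease with the level; an edge of the itinerary is maximal iff it stays constant there.  So one step of
time leaves exactly the towers below the first non-maximal edge.
\<close>

definition remaining :: "nat \<Rightarrow> (int \<Rightarrow> nat \<Rightarrow> 'v) \<Rightarrow> nat" where
  "remaining n a = len n (tower n a) - age n a"

lemma age_remaining: "a \<in> arrays \<Longrightarrow> age n a + remaining n a = len n (tower n a)"
  using age_less[of a n] by (simp add: remaining_def)

lemma remaining_pos: "a \<in> arrays \<Longrightarrow> 0 < remaining n a"
  using age_less[of a n] by (simp add: remaining_def)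

lemma remaining_0:
  assumes "a \<in> arrays"
  shows "remaining 0 a = 1"
  using age_less[OF assms, of 0] by (simp add: remaining_def len_def)

lemma remaining_le:
  assumes a: "a \<in> arrays"
  shows "remaining n a \<le> remaining (Suc n) a"
  using next_position(1)[OF tower_circ(1)[OF a, of "Suc n"] position(2)[OF a]] position(1,3)[OF a, of n]
    age_remaining[OF a, of n] age_remaining[OF a, of "Suc n"] by simp

lemma max_edge_itinerary:
  assumes a: "a \<in> arrays"
  shows "max_edge diagram pos_order (itinerary a n) \<longleftrightarrow> remaining (Suc n) a = remaining n a"
  unfolding itinerary_def max_edge_iff[OF tower_circ(1)[OF a] position(2)[OF a]]
    next_position(4)[OF tower_circ(1)[OF a] position(2)[OF a]]
  using position(1,3)[OF a, of n] age_remaining[OF a, of n] age_remaining[OF a, of "Suc n"]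
  by auto

lemma min_edge_itinerary:
  assumes a: "a \<in> arrays" and "age n a = 0" "age (Suc n) a = 0"
  shows "min_edge diagram pos_order (itinerary a n)"
  unfolding itinerary_def min_edge_iff[OF tower_circ(1)[OF a] position(2)[OF a]]
  using Min_P[OF tower_circ(1)[OF a, of "Suc n"]] assms by (simp add: position_def)

lemma age_shift_remaining:
  assumes a: "a \<in> arrays"
  shows "remaining n a = 1 \<Longrightarrow> age n (shift a) = 0"
    and "remaining n a \<noteq> 1 \<Longrightarrow> age n (shift a) = Suc (age n a) \<and> tower n (shift a) = tower n a"
  using age_shift[OF a, of n] age_remaining[OF a, of n] by auto

text \<open>
If all remaining times are 1, every tower is left at once and the new ages are all 0: the
itinerary is the maximal path and moves to the minimal one.  Otherwise let \<open>Suc M\<close> be the first level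
whose remaining time is not 1; then \<open>M\<close> is the digit that moves to its successor.
\<close>

lemma itinerary_shift:
  assumes a: "a \<in> arrays" and proper: "properly_ordered diagram pos_order"
  shows "itinerary (shift a) = vershik_map diagram pos_order (itinerary a)"
proof (cases "\<forall>n. remaining n a = 1")
  case True
  note sa = shift_arrays[OF a]
  have "max_path diagram pos_order (itinerary a)"
    using True itinerary_in_path_space[OF a] max_edge_itinerary[OF a] by (simp add: max_path_def)
  moreover have "min_path diagram pos_order (itinerary (shift a))"
    using True itinerary_in_path_space[OF sa] min_edge_itinerary[OF sa] age_shift_remaining(1)[OF a]
    by (simp add: min_path_def)
  moreover have "\<exists>!x. min_path diagram pos_order x" using proper by (simp add: properly_ordered_def)
  ultimately show ?thesis by (simp add: vershik_map_def the1_equality)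
next
  case False
  note sa = shift_arrays[OF a]
  define N where "N = (LEAST n. remaining n a \<noteq> 1)"
  have N: "remaining N a \<noteq> 1" unfolding N_def by (rule LeastI_ex) (use False in blast)
  have below: "remaining n a = 1" if "n < N" for n
    using not_less_Least[of n "\<lambda>n. remaining n a \<noteq> 1"] that unfolding N_def by blast
  from N remaining_0[OF a] obtain M where M: "N = Suc M" by (cases N) auto
  have above: "remaining n a \<noteq> 1" if "M < n" for n
  proof -
    have "remaining (Suc M) a \<le> remaining n a"
      using that lift_Suc_mono_le[of "\<lambda>n. remaining n a", OF remaining_le[OF a], of "Suc M" n] by simp
    then show ?thesis using N remaining_pos[OF a, of N] M by simp
  qed
  note below = below[unfolded M less_Suc_eq_le]
  let ?i = "tower (Suc M) a"
  have shift_above: "age n (shift a) = Suc (age n a)" "tower n (shift a) = tower n a" if "M < n" for n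
    using age_shift_remaining(2)[OF a above[OF that]] by auto
  show ?thesis
  proof (rule vershik_carry[symmetric])
    show "itinerary a \<in> topspace (path_space diagram)" "itinerary (shift a) \<in> topspace (path_space diagram)"
      using itinerary_in_path_space a sa by auto
    show "max_edge diagram pos_order (itinerary a n)" if "n < M" for n
      using that below max_edge_itinerary[OF a] by simp
    show "\<not> max_edge diagram pos_order (itinerary a M)"
      using below[of M] above[of "Suc M"] max_edge_itinerary[OF a, of M] by simp
    show "min_edge diagram pos_order (itinerary (shift a) n)" if "n < M" for n
      using that below age_shift_remaining(1)[OF a] by (intro min_edge_itinerary[OF sa]) auto
    show "edge_succ diagram pos_order (itinerary a M) = itinerary (shift a) M"
    proof -
      have q: "position M (shift a) = position M a + len M (S M ?i (position M a))"
        using shift_above(1)[of "Suc M"] age_shift_remaining(1)[OF a below[of M]]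
          below[of M] age_remaining[OF a, of M] position(1,3)[OF a, of M]
          position(1)[OF sa, of M] by simp
      have pos: "0 < len M (S M ?i (position M a))"
        using len_pos[OF tower_circ(1)[OF a, of M]] position(3)[OF a, of M] by simp
      show ?thesis
        unfolding itinerary_def shift_above(2)[of "Suc M", OF lessI]
      proof (rule edge_succ_eq[OF tower_circ(1)[OF a] position(2)[OF a]])
        show "position M (shift a) \<in> P M ?i"
          using position(2)[OF sa, of M] shift_above(2)[of "Suc M"] by simp
        show "position M a < position M (shift a)" using q pos by simp
        show "\<not> (position M a < s \<and> s < position M (shift a))" if "s \<in> P M ?i" for s
          unfolding q by (rule next_position(3)[OF tower_circ(1)[OF a] position(2)[OF a] that])
      qed
    qed
    show "itinerary (shift a) n = itinerary a n" if "M < n" for n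
      using shift_above[of n] shift_above[of "Suc n"] that by (simp add: itinerary_def position_def)
  qed
qed

lemma shift_funpow: "(shift ^^ k) a = (\<lambda>t. a (t + int k))"
  by (induction k) (auto simp: shift_def fun_eq_iff algebra_simps)

lemma offset_unbounded: "int n \<le> offset (2 * n)"
proof (induction n)
  case (Suc n)
  have "1 \<le> \<delta> (2 * n)" using len_pos[OF one_in_rk, of "2 * n"] by (simp add: \<delta>_def)
  then show ?case using Suc by (simp add: offset_def)
qed (simp add: offset_def)

lemma itinerary_eq_at_offset:
  assumes a: "a \<in> arrays" and b: "b \<in> arrays" and eq: "itinerary a = itinerary b"
  shows "a (- offset (Suc n)) (Suc n) = b (- offset (Suc n)) (Suc n)"
proof -
  have n: "tower (Suc n) a = tower (Suc n) b" "position n a = position n b" for n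
    using fun_cong[OF eq, of n] by (auto simp: itinerary_def)
  have age: "age n a = age n b" for n
  proof (induction n)
    case 0
    show ?case using age_less[OF a, of 0] age_less[OF b, of 0] by (simp add: len_def)
  next
    case (Suc m)
    then show ?case using position(1)[OF a, of m] position(1)[OF b, of m] n(2)[of m] by simp
  qed
  show ?thesis
    using array_at[OF a, of "age (Suc n) a" "Suc n"] array_at[OF b, of "age (Suc n) b" "Suc n"]
      age_less[OF a, of "Suc n"] age_less[OF b, of "Suc n"] age[of "Suc n"] n(1)[of n] by simp
qed

text \<open>
Since the itinerary of a shifted array is an image under the Vershik map, equality persists for all
positive shifts; this is used in place of any invertibility of the Vershik map.  It gives agreement
at level \<open>n\<close> from time \<open>- offset n\<close> on, and any time is of this kind for large \<open>n\<close>.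
\<close>

lemma itinerary_inject:
  assumes a: "a \<in> arrays" and b: "b \<in> arrays" and eq: "itinerary a = itinerary b"
    and proper: "properly_ordered diagram pos_order"
  shows "a = b"
proof -
  have in_arrays: "(shift ^^ k) a \<in> arrays \<and> (shift ^^ k) b \<in> arrays" for k
    by (induction k) (use a b shift_arrays in auto)
  have eqs: "itinerary ((shift ^^ k) a) = itinerary ((shift ^^ k) b)" for k
    by (induction k) (use eq itinerary_shift[OF _ proper] in_arrays in auto)
  have future: "a (- offset (Suc n) + int k) (Suc n) = b (- offset (Suc n) + int k) (Suc n)" for n k
    using itinerary_eq_at_offset[of "(shift ^^ k) a" "(shift ^^ k) b" n] in_arrays eqs
    by (simp add: shift_funpow)
  have down: "a t n = b t n" if "a t (n + d) = b t (n + d)" for t n d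
    using that
  proof (induction d)
    case (Suc d)
    then show ?case using array_proj[OF a, of t "n + d"] array_proj[OF b, of t "n + d"] by simp
  qed simp
  have "a t n = b t n" for t n
  proof -
    \<comment> \<open>a level \<open>2 * d\<close> above \<open>n\<close> that is observed from time \<open>t\<close> or earlier on\<close>
  define d where "d = Suc (n + nat (- t))"
    have "- t \<le> offset (2 * d)" using offset_unbounded[of d] unfolding d_def by linarith
    moreover obtain m where m: "2 * d = Suc m" by (cases "2 * d") (auto simp: d_def)
    ultimately have "a t (2 * d) = b t (2 * d)"
      using future[of m "nat (t + offset (2 * d))"] by simp
    moreover have "n \<le> 2 * d" by (simp add: d_def)
    ultimately show ?thesis using down[of t n "2 * d - n"] by simp
  qed
  then show ?thesis by (intro ext)
qed

text \<open>
Ages along a path add up from level 0: \<open>D n\<close> is the age that the path prescribes on level \<open>n\<close>, and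
it stays below the length of the circuit.  An orbit that enters the right circuit of level \<open>N\<close>,
shifted to the right age, has the prescribed ages on all lower levels too.
\<close>

lemma prefix_realized:
  assumes x: "x \<in> topspace (path_space diagram)"
    and T: "\<And>a k. a \<in> T \<Longrightarrow> (\<lambda>t. a (t + k)) \<in> T" "T \<subseteq> arrays"
    and reach: "\<And>n u w. (u, w) \<in> edges (G n) \<Longrightarrow> \<exists>a\<in>T. a 0 n = u \<and> a 1 n = w"
  shows "\<exists>a\<in>T. \<forall>n<N. itinerary a n = x n"
proof -
  obtain I p where I: "\<And>n. x n = edg n (I (Suc n)) (p n)" "\<And>n. I n \<in> {1..rk n}"
    "\<And>n. p n \<in> P n (I (Suc n))" "\<And>n. I n = S n (I (Suc n)) (p n)"
    using path_coordinates[OF x] by blast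
  define D where "D n = (\<Sum>j<n. p j - \<delta> j)" for n
  have D_Suc: "D (Suc n) + \<delta> n = D n + p n" for n
    using P_bounds(1)[OF I(2)[of "Suc n"] I(3)[of n]] by (simp add: D_def)
  have D_less: "D n < len n (I n)" for n
  proof (induction n)
    case 0
    then show ?case by (simp add: D_def len_def)
  next
    case (Suc n)
    have "p n + len n (I n) \<le> len (Suc n) (I (Suc n)) + \<delta> n"
      using next_position(1)[OF I(2)[of "Suc n"] I(3)[of n]] I(4)[of n] by simp
    then show ?case using Suc D_Suc[of n] by simp
  qed
  have "(v N, circ N (I N) 1) \<in> edges (G N)"
    using circ_edge[OF I(2), of 0 N] circ_0[OF I(2)] len_pos[OF I(2), of N] by simp
  then obtain b where b: "b \<in> T" "b 0 N = v N" "b 1 N = circ N (I N) 1"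
    using reach by blast
  define a where "a t = b (t + (offset N + int (D N)))" for t
  have a_T: "a \<in> T" unfolding a_def using T(1)[OF b(1)] .
  then have a: "a \<in> arrays" using T(2) by blast
  have top: "age N a = D N \<and> tower N a = I N"
    unfolding age_tower_iff[OF a I(2) D_less] by (simp add: a_def b)
  have "age (N - k) a = D (N - k) \<and> tower (N - k) a = I (N - k)" if "k \<le> N" for k
    using that
  proof (induction k)
    case 0
    then show ?case using top by simp
  next
    case (Suc k)
    define n where "n = N - Suc k"
    have n: "N - k = Suc n" using Suc.prems by (simp add: n_def)
    have IH: "age (Suc n) a = D (Suc n)" "tower (Suc n) a = I (Suc n)"
      using Suc n by simp_all
    have "age n a = D n \<and> tower n a = S n (tower (Suc n) a) (p n)"
      using age_tower_below[OF a, of "p n" n "D n"] IH D_Suc[of n] D_less[of n] I(3,4)[of n] by simp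
    then show ?case using IH(2) I(4)[of n] by (simp add: n_def)
  qed
  then have all: "age n a = D n \<and> tower n a = I n" if "n \<le> N" for n
    using that by (metis diff_diff_cancel diff_le_self)
  have "itinerary a n = x n" if "n < N" for n
    using all[of n] all[of "Suc n"] that D_Suc[of n] by (simp add: itinerary_def position_def I(1))
  then show ?thesis using a_T by blast
qed

end

section \<open>The natural extension of an inverse limit\<close>

lemma topspace_natural_extension:
  "x \<in> topspace (natural_extension X f) \<longleftrightarrow> (\<forall>i. x i \<in> topspace X) \<and> (\<forall>i. f (x i) = x (i + 1))"
  by (auto simp: natural_extension_def PiE_UNIV_domain)

lemma compact_natural_extension:
  assumes "zero_dim_system X f"
  shows "compact_space (natural_extension X f)"
proof -
  let ?P = "product_topology (\<lambda>i::int. X) UNIV"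
  have H: "Hausdorff_space X" and f: "continuous_map X X f" and "compact_space X"
    using assms by (auto simp: zero_dim_system_def metrizable_imp_Hausdorff_space)
  have coord: "continuous_map ?P X (\<lambda>x. x i)" for i
    using continuous_map_product_projection[of i UNIV "\<lambda>_. X"] by simp
  have "closedin ?P {x \<in> topspace ?P. f (x i) = x (i + 1)}" for i
    using closedin_continuous_maps_eq[OF H continuous_map_compose[OF coord f] coord, of i "i + 1"]
    by (simp add: o_def)
  then have "closedin ?P (\<Inter>i. {x \<in> topspace ?P. f (x i) = x (i + 1)})"
    by (intro closedin_Inter) auto
  moreover have "compact_space ?P"
    using \<open>compact_space X\<close> by (simp add: compact_space_product_topology)
  ultimately have "compact_space (subtopology ?P (\<Inter>i. {x \<in> topspace ?P. f (x i) = x (i + 1)}))"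
    by (intro compact_space_subtopology closedin_compact_space)
  moreover have "(\<Inter>i. {x \<in> topspace ?P. f (x i) = x (i + 1)}) = topspace ?P \<inter> {x. \<forall>i. f (x i) = x (i + 1)}"
    by auto
  ultimately show ?thesis
    by (simp only: natural_extension_def subtopology_restrict)
qed

lemma full_orbit_through:
  assumes surj: "f ` topspace X = topspace X" and y: "y \<in> topspace X"
  shows "\<exists>x\<in>topspace (natural_extension X f). x 0 = y"
proof -
  define b where "b = inv_into (topspace X) f"
  have b: "b z \<in> topspace X" "f (b z) = z" if "z \<in> topspace X" for z
    unfolding b_def using that surj by (auto intro: inv_into_into f_inv_into_f)
  have b_pow: "(b ^^ k) y \<in> topspace X" for k by (induction k) (use y b in auto)
  have f_pow: "(f ^^ k) y \<in> topspace X" for k by (induction k) (use y surj in auto)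
  define x where "x i = (if i \<ge> 0 then (f ^^ nat i) y else (b ^^ nat (- i)) y)" for i :: int
  have "f (x i) = x (i + 1)" for i
  proof (cases "i \<ge> 0")
    case True
    then have "nat (i + 1) = Suc (nat i)" by simp
    then show ?thesis using True by (simp add: x_def)
  next
    case False
    then have "nat (- i) = Suc (nat (- (i + 1)))" by simp
    then have "f (x i) = (b ^^ nat (- (i + 1))) y"
      using False b(2)[OF b_pow] by (simp add: x_def)
    then show ?thesis using False by (cases "i = -1") (auto simp: x_def)
  qed
  then have "x \<in> topspace (natural_extension X f)"
    unfolding topspace_natural_extension using b_pow f_pow by (auto simp: x_def)
  then show ?thesis by (intro bexI[of _ x]) (auto simp: x_def)
qed

context gm_system
begin

lemma topspace_inverse_limit:
  "x \<in> topspace (inverse_limit G \<phi>) \<longleftrightarrow>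
     (\<forall>n. x n \<in> verts (G n)) \<and> (\<forall>i. x i = \<phi> (Suc i) (x (Suc i)))"
  unfolding inverse_limit_def by (simp add: PiE_UNIV_domain Pi_iff)

text \<open>
The directional property is what makes the inverse limit relation a function: all edges out of
\<open>x (Suc i)\<close> end in vertices with the same image on level \<open>i\<close>.
\<close>

lemma successor_unique:
  assumes x: "x \<in> topspace (inverse_limit G \<phi>)"
    and y: "y \<in> topspace (inverse_limit G \<phi>)" "\<forall>i. (x i, y i) \<in> edges (G i)"
    and z: "\<forall>i. \<exists>w. (x (Suc i), w) \<in> edges (G (Suc i)) \<and> z i = \<phi> (Suc i) w"
  shows "y = z"
proof
  fix i
  obtain w where "(x (Suc i), w) \<in> edges (G (Suc i))" "z i = \<phi> (Suc i) w" using z by blast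
  moreover have "y i = \<phi> (Suc i) (y (Suc i))" using y(1) unfolding topspace_inverse_limit by blast
  ultimately show "y i = z i" using hom_directional y(2) by metis
qed

lemma inverse_limit_map:
  assumes x: "x \<in> topspace (inverse_limit G \<phi>)"
  shows "inverse_limit_map G \<phi> x \<in> topspace (inverse_limit G \<phi>)"
    and "(x i, inverse_limit_map G \<phi> x i) \<in> edges (G i)"
    and "y \<in> topspace (inverse_limit G \<phi>) \<Longrightarrow> \<forall>i. (x i, y i) \<in> edges (G i) \<Longrightarrow>
      inverse_limit_map G \<phi> x = y"
proof -
  have xv: "x i \<in> verts (G i)" and xp: "x i = \<phi> (Suc i) (x (Suc i))" for i
    using x unfolding topspace_inverse_limit by blast+
  have "\<forall>i. \<exists>w. (x i, w) \<in> edges (G i)"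
    using xv graph_G unfolding is_graph_def by blast
  then obtain w where w: "\<And>i. (x i, w i) \<in> edges (G i)" by metis
  define z where "z i = \<phi> (Suc i) (w (Suc i))" for i
  have z_edge: "(x i, z i) \<in> edges (G i)" for i
    using hom_edge[OF w[of "Suc i"]] xp[of i] by (simp add: z_def)
  have "z i = \<phi> (Suc i) (z (Suc i))" for i
    using hom_directional[OF w z_edge] by (simp add: z_def[of i])
  then have z: "z \<in> topspace (inverse_limit G \<phi>)"
    unfolding topspace_inverse_limit using z_edge edge_verts by blast
  have z_form: "\<forall>i. \<exists>w. (x (Suc i), w) \<in> edges (G (Suc i)) \<and> z i = \<phi> (Suc i) w"
    using w z_def by blast
  have eq: "inverse_limit_map G \<phi> x = z"
    unfolding inverse_limit_map_def
    by (rule the_equality) (use z z_edge successor_unique[OF x _ _ z_form] in blast)+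
  show "inverse_limit_map G \<phi> x \<in> topspace (inverse_limit G \<phi>)"
    "(x i, inverse_limit_map G \<phi> x i) \<in> edges (G i)" using eq z z_edge by auto
  show "inverse_limit_map G \<phi> x = y"
    if "y \<in> topspace (inverse_limit G \<phi>)" "\<forall>i. (x i, y i) \<in> edges (G i)"
    using successor_unique[OF x that z_form] eq by simp
qed

text \<open>
An edge of level \<open>n\<close> is lifted step by step to the levels above, by edge-surjectivity, and projected
to the levels below.
\<close>

lemma edge_extends:
  assumes "(u, w) \<in> edges (G n)"
  shows "\<exists>x y. x \<in> topspace (inverse_limit G \<phi>) \<and> y \<in> topspace (inverse_limit G \<phi>) \<and>
    (\<forall>i. (x i, y i) \<in> edges (G i)) \<and> x n = u \<and> y n = w"
proof -
  have "\<exists>e. \<forall>k. (e k \<in> edges (G (n + k)) \<and> (k = 0 \<longrightarrow> e k = (u, w))) \<and>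
      map_prod (\<phi> (Suc (n + k))) (\<phi> (Suc (n + k))) (e (Suc k)) = e k"
  proof (rule dependent_nat_choice)
    show "\<exists>e. e \<in> edges (G (n + 0)) \<and> (0 = (0::nat) \<longrightarrow> e = (u, w))" using assms by auto
    fix e k assume e: "e \<in> edges (G (n + k)) \<and> (k = 0 \<longrightarrow> e = (u, w))"
    then obtain u' w' where "(u', w') \<in> edges (G (Suc (n + k)))"
      "\<phi> (Suc (n + k)) u' = fst e" "\<phi> (Suc (n + k)) w' = snd e"
      using edge_lift[of "fst e" "snd e" "n + k"] by auto
    then show "\<exists>e'. (e' \<in> edges (G (n + Suc k)) \<and> (Suc k = 0 \<longrightarrow> e' = (u, w))) \<and>
      map_prod (\<phi> (Suc (n + k))) (\<phi> (Suc (n + k))) e' = e"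
      by (intro exI[of _ "(u', w')"]) simp
  qed
  then obtain e where e: "\<And>k. e k \<in> edges (G (n + k))" "e 0 = (u, w)"
    "\<And>k. map_prod (\<phi> (Suc (n + k))) (\<phi> (Suc (n + k))) (e (Suc k)) = e k" by blast
  \<comment> \<open>\<open>g k\<close> is the projection of the edge \<open>(u, w)\<close> to level \<open>n - k\<close>.\<close>
  define g where "g = rec_nat (u, w) (\<lambda>k x. map_prod (\<phi> (n - k)) (\<phi> (n - k)) x)"
  have g: "g 0 = (u, w)" "\<And>k. g (Suc k) = map_prod (\<phi> (n - k)) (\<phi> (n - k)) (g k)"
    by (simp_all add: g_def)
  define E where "E i = (if n \<le> i then e (i - n) else g (n - i))" for i
  have E_proj: "E i = map_prod (\<phi> (Suc i)) (\<phi> (Suc i)) (E (Suc i))" for i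
  proof (cases "n \<le> i")
    case True
    then show ?thesis using e(3)[of "i - n"] by (simp add: E_def Suc_diff_le)
  next
    case False
    have "E (Suc i) = g (n - Suc i)"
      using False e(2) g(1) by (cases "n = Suc i") (auto simp: E_def)
    moreover have "n - i = Suc (n - Suc i)" "n - (n - Suc i) = Suc i" using False by auto
    ultimately show ?thesis using False g(2)[of "n - Suc i"] by (simp add: E_def)
  qed
  have E_edge: "E i \<in> edges (G i)" for i
  proof (cases "n \<le> i")
    case True
    then show ?thesis using e(1)[of "i - n"] by (simp add: E_def)
  next
    case False
    have "E (n - k) \<in> edges (G (n - k))" if "k \<le> n" for k
      using that
    proof (induction k)
      case 0
      then show ?case using e(1)[of 0] by (simp add: E_def)
    next
      case (Suc k)
      then have "Suc (n - Suc k) = n - k" by simp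
      then show ?case
        using Suc hom_edge[of "fst (E (n - k))" "snd (E (n - k))" "n - Suc k"] E_proj[of "n - Suc k"]
        by (simp add: map_prod_def split: prod.splits)
    qed
    from this[of "n - i"] show ?thesis using False by simp
  qed
  let ?x = "\<lambda>i. fst (E i)" and ?y = "\<lambda>i. snd (E i)"
  have edges: "(?x i, ?y i) \<in> edges (G i)" for i using E_edge[of i] by simp
  have "?x i = \<phi> (Suc i) (?x (Suc i))" "?y i = \<phi> (Suc i) (?y (Suc i))" for i
    by (subst E_proj, simp)+
  then have "?x \<in> topspace (inverse_limit G \<phi>)" "?y \<in> topspace (inverse_limit G \<phi>)"
    unfolding topspace_inverse_limit using edges edge_verts by blast+
  moreover have "?x n = u" "?y n = w" using e(2) by (auto simp: E_def)
  ultimately show ?thesis using edges by (intro exI[of _ ?x] exI[of _ ?y]) simp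
qed

lemma continuous_map_itinerary:
  assumes X: "\<And>x. x \<in> topspace X \<Longrightarrow> A x \<in> arrays"
    and cont: "\<And>k n. continuous_map X (discrete_topology (verts (G n))) (\<lambda>x. A x k n)"
  shows "continuous_map X (path_space diagram) (\<lambda>x. itinerary (A x))"
proof -
  have value_open: "openin X {x \<in> topspace X. A x k n = u}" for k n u
  proof -
    have "openin X {x \<in> topspace X. A x k n \<in> verts (G n) \<inter> {u}}"
      by (rule openin_continuous_map_preimage[OF cont]) simp
    moreover have "A x k n \<in> verts (G n)" if "x \<in> topspace X" for x
      using continuous_map_image_subset_topspace[OF cont, of k n] that by auto
    ultimately show ?thesis by (smt (verit) Collect_cong Int_iff singleton_iff)
  qed
  have age_tower_open: "openin X {x \<in> topspace X. age n (A x) = d \<and> tower n (A x) = i}" (is "openin X ?U") for n d i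
  proof (cases "i \<in> {1..rk n} \<and> d < len n i")
    case True
    have "?U = {x \<in> topspace X. A x (- offset n - int d) n = v n} \<inter>
               {x \<in> topspace X. A x (- offset n - int d + 1) n = circ n i 1}"
      using age_tower_iff[OF X] True by auto
    then show ?thesis using value_open by (simp add: openin_Int)
  next
    case False
    then have "?U = {}" using tower_circ(1)[OF X] age_less[OF X] by blast
    then show ?thesis by (simp only: openin_empty)
  qed
  have "continuous_map X (discrete_topology (bedges diagram (Suc n))) (\<lambda>x. itinerary (A x) n)" for n
    unfolding continuous_map_def
  proof (intro conjI allI impI)
    show "(\<lambda>x. itinerary (A x) n) \<in> topspace X \<rightarrow> topspace (discrete_topology (bedges diagram (Suc n)))"
      using itinerary_in_path_space[OF X] unfolding path_space_iff by auto
    fix U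
    show "openin X {x \<in> topspace X. itinerary (A x) n \<in> U}"
    proof (subst openin_subopen, intro ballI)
      fix x assume x: "x \<in> {x \<in> topspace X. itinerary (A x) n \<in> U}"
      let ?W = "{y \<in> topspace X. age n (A y) = age n (A x) \<and> tower n (A y) = tower n (A x)} \<inter>
        {y \<in> topspace X. age (Suc n) (A y) = age (Suc n) (A x) \<and> tower (Suc n) (A y) = tower (Suc n) (A x)}"
      have "openin X ?W" by (intro openin_Int age_tower_open)
      moreover have "?W \<subseteq> {x \<in> topspace X. itinerary (A x) n \<in> U}"
        using x by (auto simp: itinerary_def position_def)
      ultimately show "\<exists>T. openin X T \<and> x \<in> T \<and> T \<subseteq> {x \<in> topspace X. itinerary (A x) n \<in> U}"
        using x by (intro exI[of _ ?W]) simp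
    qed
  qed
  then show ?thesis
    unfolding path_space_def continuous_map_in_subtopology continuous_map_componentwise_UNIV
    using itinerary_in_path_space[OF X] unfolding path_space_iff by auto
qed

lemma Hausdorff_path_space: "Hausdorff_space (path_space diagram)"
  unfolding path_space_def
  by (intro Hausdorff_space_subtopology) (simp add: Hausdorff_space_product_topology)

text \<open>
The itinerary map is a continuous injection of a compact space into a Hausdorff space, so it remains
to see that it is onto.  Its image is closed, and it contains points that agree with a given path
on arbitrarily long initial segments.
\<close>

lemma conjugate_natural_extension:
  fixes X :: "'a topology"
  assumes sys: "zero_dim_system X f"
    and conj: "conjugate_systems X f (inverse_limit G \<phi>) (inverse_limit_map G \<phi>)"
    and simple: "gm_simple G \<phi> r c"
  shows "conjugate_systems (natural_extension X f) shift (path_space diagram) (vershik_map diagram pos_order)"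
proof -
  let ?Y = "inverse_limit G \<phi>" and ?X = "natural_extension X f"
  note proper = properly_ordered_diagram[OF simple]
  obtain h where h: "homeomorphic_map X ?Y h"
    and hf: "\<And>x. x \<in> topspace X \<Longrightarrow> h (f x) = inverse_limit_map G \<phi> (h x)"
    using conj unfolding conjugate_systems_def by blast
  have h_cont: "continuous_map X ?Y h" and h_img: "h ` topspace X = topspace ?Y"
    and h_inj: "inj_on h (topspace X)"
    using h homeomorphic_imp_continuous_map homeomorphic_imp_surjective_map
      homeomorphic_imp_injective_map by blast+
  define A where "A x = (\<lambda>k. h (x k))" for x :: "int \<Rightarrow> 'a"
  have A_in: "A x \<in> arrays" if "x \<in> topspace ?X" for x
  proof -
    have x: "x k \<in> topspace X" "f (x k) = x (k + 1)" for k
      using that by (auto simp: topspace_natural_extension)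
    have Y: "h (x k) \<in> topspace ?Y" for k using h_img x(1) by blast
    have "(A x k n, A x (k + 1) n) \<in> edges (G n)" for k n
      using inverse_limit_map(2)[OF Y, of k n] hf[OF x(1), of k] x(2)[of k] by (simp add: A_def)
    moreover have "A x k n = \<phi> (Suc n) (A x k (Suc n))" for k n
      using Y[of k] unfolding topspace_inverse_limit A_def by blast
    ultimately show ?thesis unfolding arrays_def by blast
  qed
  have A_shift: "A (\<lambda>t. x (t + k)) = (\<lambda>t. A x (t + k))" for x k by (simp add: A_def)
  have shift_in: "(\<lambda>t. x (t + k)) \<in> topspace ?X" if "x \<in> topspace ?X" for x k
    using that unfolding topspace_natural_extension by (metis add.assoc add.commute)
  have A_cont: "continuous_map ?X (discrete_topology (verts (G n))) (\<lambda>x. A x k n)" for k n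
  proof -
    have "continuous_map ?X X (\<lambda>x. x k)"
      unfolding natural_extension_def
      by (intro continuous_map_from_subtopology continuous_map_product_projection) simp
    moreover have "continuous_map ?Y (discrete_topology (verts (G n))) (\<lambda>y. y n)"
      unfolding inverse_limit_def
      by (intro continuous_map_from_subtopology continuous_map_product_projection) simp
    ultimately have "continuous_map ?X (discrete_topology (verts (G n))) ((\<lambda>y. y n) \<circ> (h \<circ> (\<lambda>x. x k)))"
      using h_cont by (intro continuous_map_compose)
    then show ?thesis by (simp add: o_def A_def)
  qed
  define H where "H x = itinerary (A x)" for x
  have H_cont: "continuous_map ?X (path_space diagram) H"
    unfolding H_def using continuous_map_itinerary[OF A_in A_cont] .
  have H_inj: "inj_on H (topspace ?X)"
  proof (rule inj_onI)
    fix x y assume xy: "x \<in> topspace ?X" "y \<in> topspace ?X" "H x = H y"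
    then have "A x = A y" using itinerary_inject[OF A_in A_in _ proper] by (simp add: H_def)
    then have "h (x k) = h (y k)" for k by (metis A_def)
    then have "x k = y k" for k
      using inj_onD[OF h_inj, of "x k" "y k"] xy(1,2) unfolding topspace_natural_extension by blast
    then show "x = y" by (intro ext)
  qed
  have reach: "\<exists>a\<in>A ` topspace ?X. a 0 n = u \<and> a 1 n = w" if uw: "(u, w) \<in> edges (G n)" for n u w
  proof -
    obtain y z where yz: "y \<in> topspace ?Y" "z \<in> topspace ?Y" "\<forall>i. (y i, z i) \<in> edges (G i)"
      "y n = u" "z n = w" using edge_extends[OF uw] by blast
    have "y \<in> h ` topspace X" using yz(1) h_img by simp
    then obtain x0 where x0: "x0 \<in> topspace X" "h x0 = y" by blast
    have "f ` topspace X = topspace X" using sys by (simp add: zero_dim_system_def)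
    from full_orbit_through[OF this x0(1)]
    obtain x where x: "x \<in> topspace ?X" "x 0 = x0" by blast
    have "f (x 0) = x (0 + 1)" using x(1) unfolding topspace_natural_extension by blast
    then have "h (x 1) = z"
      using hf[OF x0(1)] inverse_limit_map(3)[OF yz(1,2,3)] x(2) x0(2) by simp
    then show ?thesis using x x0(2) yz(4,5) by (intro bexI[of _ "A x"]) (auto simp: A_def)
  qed
  have H_surj: "H ` topspace ?X = topspace (path_space diagram)"
  proof
    show "H ` topspace ?X \<subseteq> topspace (path_space diagram)"
      using continuous_map_image_subset_topspace[OF H_cont] .
    show "topspace (path_space diagram) \<subseteq> H ` topspace ?X"
    proof
      fix p assume p: "p \<in> topspace (path_space diagram)"
      have "\<exists>a\<in>A ` topspace ?X. \<forall>n<N. itinerary a n = p n" for N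
      proof (rule prefix_realized[OF p])
        show "(\<lambda>t. a (t + k)) \<in> A ` topspace ?X" if "a \<in> A ` topspace ?X" for a k
        proof -
          from that obtain x where x: "x \<in> topspace ?X" "a = A x" by blast
          show ?thesis
            unfolding x(2) A_shift[symmetric] by (rule imageI[OF shift_in[OF x(1)]])
        qed
        show "A ` topspace ?X \<subseteq> arrays" using A_in by blast
      qed (rule reach)
      then have "\<forall>N. \<exists>x. x \<in> topspace ?X \<and> (\<forall>n<N. H x n = p n)" by (auto simp: H_def)
      then obtain s where s: "\<And>N. s N \<in> topspace ?X" "\<And>N n. n < N \<Longrightarrow> H (s N) n = p n" by metis
      have in_path: "H (s N) \<in> topspace (path_space diagram)" for N
        using continuous_map_image_subset_topspace[OF H_cont] s(1) by blast
      have "limitin (path_space diagram) (\<lambda>N. H (s N)) p sequentially"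
        unfolding path_space_def limitin_subtopology limitin_componentwise
      proof (intro conjI ballI)
        show "p \<in> {x. \<forall>n. rng diagram (x n) = src diagram (x (Suc n))}"
          using p unfolding path_space_iff by blast
        show "\<forall>\<^sub>F N in sequentially. H (s N) \<in> {x. \<forall>n. rng diagram (x n) = src diagram (x (Suc n))}"
          using in_path unfolding path_space_iff by (intro always_eventually allI) blast
        show "p \<in> extensional UNIV" by simp
        show "\<forall>\<^sub>F N in sequentially. H (s N) \<in> topspace
           (product_topology (\<lambda>n. discrete_topology (bedges diagram (Suc n))) UNIV)"
          using in_path unfolding path_space_iff by (intro always_eventually) (simp add: PiE_UNIV_domain)
        fix n
        have "p n \<in> bedges diagram (Suc n)" using p unfolding path_space_iff by blast
        moreover have "\<forall>\<^sub>F N in sequentially. H (s N) n = p n"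
          using s(2) by (intro eventually_sequentiallyI[of "Suc n"]) simp
        ultimately show "limitin (discrete_topology (bedges diagram (Suc n))) (\<lambda>N. H (s N) n) (p n) sequentially"
          unfolding limitin_def by (auto elim: eventually_mono)
      qed
      moreover have "closedin (path_space diagram) (H ` topspace ?X)"
        using image_compactin[OF _ H_cont] compact_natural_extension[OF sys]
        by (intro compactin_imp_closedin[OF Hausdorff_path_space]) (auto simp: compact_space_def)
      ultimately show "p \<in> H ` topspace ?X"
        by (rule limitin_closedin) (use s(1) in auto)
    qed
  qed
  have "homeomorphic_map ?X (path_space diagram) H"
    using continuous_imp_homeomorphic_map[OF H_cont _ _ H_surj H_inj]
      compact_natural_extension[OF sys] Hausdorff_path_space by blast
  moreover have "H (shift x) = vershik_map diagram pos_order (H x)" if "x \<in> topspace ?X" for x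
    using itinerary_shift[OF A_in[OF that] proper] A_shift[of x 1] by (simp add: H_def shift_def[abs_def])
  ultimately show ?thesis unfolding conjugate_systems_def by blast
qed

end

section \<open>The rank inequality\<close>

theorem theorem5p1:
  fixes X :: "'a topology" and f :: "'a \<Rightarrow> 'a" and K :: enat
  assumes "zero_dim_system X f"
    and "minimal_system X f"
    and "1 \<le> K"
    and "has_topological_rank X f K"
  shows "\<exists>K'\<le>K. has_homeo_topological_rank (natural_extension X f) shift K'"
proof -
  have "K \<in> gm_ranks X f"
    using assms(4) by (simp add: has_topological_rank_def is_minimum_def)
  then obtain G :: "nat \<Rightarrow> nat graph" and \<phi> v r c where K: "K = gm_rank r"
    and gm: "gm_covering G \<phi> v r c" and simple: "gm_simple G \<phi> r c"
    and conj: "conjugate_systems X f (inverse_limit G \<phi>) (inverse_limit_map G \<phi>)"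
    unfolding gm_ranks_def by blast
  interpret gm_system G \<phi> v r c using gm by unfold_locales
  have K_in: "K \<in> bv_ranks (natural_extension X f) shift"
    unfolding bv_ranks_def K
    using bratteli_rank_diagram properly_ordered_diagram[OF simple]
      conjugate_natural_extension[OF assms(1) conj simple] by force
  let ?K = "LEAST k. k \<in> bv_ranks (natural_extension X f) shift"
  have "?K \<in> bv_ranks (natural_extension X f) shift" using K_in by (rule LeastI)
  then have "has_homeo_topological_rank (natural_extension X f) shift ?K"
    unfolding has_homeo_topological_rank_def is_minimum_def by (auto intro: Least_le)
  then show ?thesis using Least_le[of "\<lambda>k. k \<in> bv_ranks (natural_extension X f) shift", OF K_in] by blast
qed

end
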